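(* Let $G$ be a tree on $k$ vertices and $n\ge 1$. Then $$\begin{aligned}W(\Gamma^G_n)&=\frac{(k-1)^2(2k^2-2k-1)}{k^3(2k-1)}\,2^nk^{2n}-\frac{2(k-1)^2}{k^2}\,nk^{2n}+\frac{2(k+1)(k-1)}{k^3}\,k^{2n}-\frac{2(k+1)(k-1)}{k(2k-1)}\,k^n\\&\quad+\left(\frac{2}{k^2}\,nk^{2n}-\frac{k^2+2}{k^3(k-1)}\,k^{2n}+\frac{k+2}{k^2(k-1)}\,k^n\right)W(G).\end{aligned}$$
   Context: Let $G=(V,E)$ be a finite tree with vertex set $V$ of size $k$, and fix an orientation of each edge, so that each edge becomes an ordered pair $e=(s,t)$. Each oriented edge $e=(s,t)$ acts on the set $V^*$ of finite words over the alphabet $V$ by the recursive rule: $e(\emptyset)=\emptyset$, $e(sw)=t\,e(w)$, $e(tw)=sw$, and $e(xw)=xw$ for $x\in V\setminus\{s,t\}$ (words are read left to right, $w\in V^*$). This action preserves word length. For $n\ge 1$, the Schreier graph $\Gamma_n^G$ is the multigraph with vertex set $V^n$ having, for each $u\in V^n$ and each oriented edge $e$ of $G$, one edge joining $u$ and $e(u)$, labelled $e$ (a loop if $e(u)=u$). For a connected graph $H$, the Wiener index is $W(H)=\sum_{\{u,v\}}d_H(u,v)$, the sum of graph distances over all unordered pairs of vertices. *)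

theory Defs
  imports Complex_Main
begin

(* Undirected adjacency induced by a set of oriented edges *)
definition adj :: "('a \<times> 'a) set \<Rightarrow> 'a \<Rightarrow> 'a \<Rightarrow> bool" where
  "adj E x y \<longleftrightarrow> (x, y) \<in> E \<or> (y, x) \<in> E"

(* A cycle: at least 3 distinct vertices, consecutive ones (cyclically) adjacent *)
definition is_cycle :: "('a \<times> 'a) set \<Rightarrow> 'a list \<Rightarrow> bool" where
  "is_cycle E cs \<longleftrightarrow> length cs \<ge> 3 \<and> distinct cs \<and>
     (\<forall>i < length cs. adj E (cs ! i) (cs ! ((i + 1) mod length cs)))"

(* A finite tree with vertex set V whose edges are oriented: E contains, for each
   (undirected) edge of the tree, exactly one orientation (s,t). *)
definition oriented_tree :: "'a set \<Rightarrow> ('a \<times> 'a) set \<Rightarrow> bool" where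
  "oriented_tree V E \<longleftrightarrow> finite V \<and> V \<noteq> {} \<and> E \<subseteq> V \<times> V \<and>
     (\<forall>(s, t) \<in> E. s \<noteq> t \<and> (t, s) \<notin> E) \<and>
     (\<forall>u \<in> V. \<forall>v \<in> V. (u, v) \<in> {(x, y). adj E x y}\<^sup>*) \<and>
     (\<not> (\<exists>cs. set cs \<subseteq> V \<and> is_cycle E cs))"

(* Action of the oriented edge e = (s,t) on words *)
fun edge_act :: "'a \<times> 'a \<Rightarrow> 'a list \<Rightarrow> 'a list" where
  "edge_act e [] = []"
| "edge_act (s, t) (x # w) =
     (if x = s then t # edge_act (s, t) w
      else if x = t then s # w
      else x # w)"

(* Words of length n over V *)
definition words :: "'a set \<Rightarrow> nat \<Rightarrow> 'a list set" where
  "words V n = {w. length w = n \<and> set w \<subseteq> V}"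

(* Adjacency relation of the Schreier graph Gamma_n (undirected: u -- e(u)) *)
definition schreier_rel :: "'a set \<Rightarrow> ('a \<times> 'a) set \<Rightarrow> nat \<Rightarrow> ('a list \<times> 'a list) set" where
  "schreier_rel V E n =
     {(u, v). u \<in> words V n \<and> v \<in> words V n \<and>
              (\<exists>e \<in> E. v = edge_act e u \<or> u = edge_act e v)}"

(* Graph distance w.r.t. an adjacency relation R: least number of steps *)
definition gdist :: "('b \<times> 'b) set \<Rightarrow> 'b \<Rightarrow> 'b \<Rightarrow> nat" where
  "gdist R u v = (LEAST m. (u, v) \<in> R ^^ m)"

(* Wiener index: sum of distances over unordered pairs = half the ordered sum *)
definition wiener :: "'b set \<Rightarrow> ('b \<times> 'b) set \<Rightarrow> real" where
  "wiener X R = (\<Sum>u\<in>X. \<Sum>v\<in>X. real (gdist R u v)) / 2"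

end

theory Submission
  imports Defs "HOL-Library.Sublist"
begin

text \<open>
  The Schreier graph is a cactus: an oriented edge \<open>e = (s, t)\<close> acts on words over \<open>{s, t}\<close> as an adding
  machine, so its orbits are cycles \<open>{s, t}\<^sup>m \<tau>\<close> of length \<open>2\<^sup>m\<close>, where the suffix \<open>\<tau>\<close> is empty or starts
  with a letter outside \<open>{s, t}\<close>.  Each word has a projection to each cycle; one step along \<open>e\<close> changes
  only the projection to the \<open>e\<close>-cycle through the current word, and distinct words have distinct
  projections to some cycle through the first of them.  Hence the distance of two words is the sum,
  over all cycles, of the circular distances of their projections.

  Let \<open>e\<close> split the tree into parts of \<open>a\<close> and \<open>b\<close> vertices, \<open>a + b = k\<close>.  Splitting off the last
  letter evaluates the sum of circular distances over all pairs of projections to the full cycle of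
  level \<open>m + 1\<close>: the four choices of two last letters in \<open>{s, t}\<close> contribute \<open>2 * 2\<^sup>m\<close> together, whatever
  the remaining letters are.  The result depends on \<open>e\<close> only through \<open>a b\<close>, and \<open>\<Sum> a b = W(G)\<close>.
\<close>

section \<open>A criterion for graph distances\<close>

text \<open>One step lowers \<open>D\<close> by at most 1, so no walk from \<open>u\<close> to
  \<open>v\<close> is shorter than \<open>D u v\<close>; away from \<open>v\<close> some step lowers
  \<open>D\<close>, so greedy descent gives a walk of at most that length. It serves both the tree
  and the Schreier graph.\<close>

lemma int_gdist_eqI:
  fixes D :: "'b \<Rightarrow> 'b \<Rightarrow> int"
  assumes D_refl: "\<And>u. u \<in> X \<Longrightarrow> D u u = 0"
    and D_step: "\<And>u u' v. (u, u') \<in> R \<Longrightarrow> u \<in> X \<Longrightarrow> v \<in> X \<Longrightarrow> u' \<in> X \<and> D u v \<le> D u' v + 1"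
    and D_nonneg: "\<And>u v. u \<in> X \<Longrightarrow> v \<in> X \<Longrightarrow> D u v \<ge> 0"
    and D_descent: "\<And>u v. u \<in> X \<Longrightarrow> v \<in> X \<Longrightarrow> u \<noteq> v \<Longrightarrow> \<exists>u'. (u, u') \<in> R \<and> D u' v < D u v"
    and "u \<in> X" "v \<in> X"
  shows "int (gdist R u v) = D u v"
proof -
  have lower: "D u v \<le> int m" if "(u, v) \<in> R ^^ m" "u \<in> X" "v \<in> X" for m u
    using that
  proof (induction m arbitrary: u)
    case 0
    then show ?case using D_refl by auto
  next
    case (Suc m)
    then obtain u' where u': "(u, u') \<in> R" "(u', v) \<in> R ^^ m"
      by (meson relpow_Suc_D2)
    with Suc D_step[of u u' v] show ?case by force
  qed
  have upper: "\<exists>m. int m \<le> d \<and> (u, v) \<in> R ^^ m" if "d = D u v" "u \<in> X" for u d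
    using that
  proof (induction "nat d" arbitrary: u d rule: less_induct)
    case less
    show ?case
    proof (cases "u = v")
      case True
      then show ?thesis using less.prems D_nonneg \<open>v \<in> X\<close> by (intro exI[of _ 0]) auto
    next
      case False
      then obtain u' where u': "(u, u') \<in> R" "D u' v < D u v"
        using D_descent less.prems \<open>v \<in> X\<close> by blast
      have "u' \<in> X" using D_step u'(1) less.prems \<open>v \<in> X\<close> by blast
      moreover have "nat (D u' v) < nat d"
        using u'(2) less.prems(1) D_nonneg[OF \<open>u' \<in> X\<close> \<open>v \<in> X\<close>] by linarith
      ultimately obtain m where "int m \<le> D u' v" "(u', v) \<in> R ^^ m"
        using less.hyps by blast
      then have "(u, v) \<in> R ^^ Suc m" "int (Suc m) \<le> d"
        using u' less.prems relpow_Suc_I2[of u u' R v m] by linarith+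
      then show ?thesis by blast
    qed
  qed
  obtain m where m: "int m \<le> D u v" "(u, v) \<in> R ^^ m" using upper[OF refl \<open>u \<in> X\<close>] by blast
  have "gdist R u v \<le> m" unfolding gdist_def using m(2) by (rule Least_le)
  moreover have "(u, v) \<in> R ^^ gdist R u v" unfolding gdist_def using m(2) by (rule LeastI)
  ultimately show ?thesis using m(1) lower[of u "gdist R u v"] assms by linarith
qed

section \<open>Distances on a single cycle\<close>

definition circ_dist :: "int \<Rightarrow> int \<Rightarrow> int \<Rightarrow> int" where
  "circ_dist N a b = min \<bar>a - b\<bar> (N - \<bar>a - b\<bar>)"

definition circ_succ :: "int \<Rightarrow> int \<Rightarrow> int" where
  "circ_succ N a = (if a + 1 = N then 0 else a + 1)"

lemma circ_dist_refl: "N \<ge> 0 \<Longrightarrow> circ_dist N a a = 0"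
  by (simp add: circ_dist_def)

lemma circ_dist_commute: "circ_dist N a b = circ_dist N b a"
  by (simp add: circ_dist_def abs_minus_commute)

lemma circ_dist_nonneg: "a \<in> {0..<N} \<Longrightarrow> b \<in> {0..<N} \<Longrightarrow> circ_dist N a b \<ge> 0"
  by (auto simp: circ_dist_def)

lemma circ_dist_succ_le:
  assumes "a \<in> {0..<N}" "b \<in> {0..<N}"
  shows "\<bar>circ_dist N (circ_succ N a) b - circ_dist N a b\<bar> \<le> 1"
  using assms unfolding circ_dist_def circ_succ_def atLeastLessThan_iff min_def abs_if
  by (smt (verit))

text \<open>One of the two neighbours of \<open>a\<close> lies on a shortest arc to
  \<open>b\<close>. The predecessor is given implicitly as \<open>c\<close>, which fits a word whose
  image under the edge is the current word.\<close>

lemma circ_dist_descent: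
  assumes "a \<in> {0..<N}" "b \<in> {0..<N}" "c \<in> {0..<N}" "circ_succ N c = a" "a \<noteq> b"
  shows "circ_dist N (circ_succ N a) b < circ_dist N a b \<or> circ_dist N c b < circ_dist N a b"
  using assms unfolding circ_dist_def circ_succ_def atLeastLessThan_iff min_def abs_if
  by (smt (verit))

section \<open>Positions of words on cycles\<close>

lemma length_edge_act [simp]: "length (edge_act e w) = length w"
  by (induction e w rule: edge_act.induct) auto

lemma edge_act_inverse: "s \<noteq> t \<Longrightarrow> edge_act (s, t) (edge_act (t, s) w) = w"
  by (induction w) auto

lemma set_edge_act: "set (edge_act (s, t) w) \<subseteq> set w \<union> {s, t}"
  by (induction w) auto

text \<open>The carry passes only through letters of \<open>{s, t}\<close>, so it cannot enter a
  suffix that begins with another letter.\<close>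

lemma edge_act_append:
  "v = [] \<or> hd v \<notin> {s, t} \<Longrightarrow> edge_act (s, t) (w @ v) = edge_act (s, t) w @ v"
proof (induction w)
  case Nil
  then show ?case by (cases v) auto
qed auto

text \<open>
  Let \<open>A\<close> be the set of ends of an edge \<open>e = (s, t)\<close> and let \<open>f\<close> map each letter to its side of \<open>e\<close>, with
  \<open>f s = 1\<close> and \<open>f t = 0\<close>.  Words over \<open>A\<close> are binary numbers, least significant digit first, on which
  \<open>e\<close> acts by adding one.  An arbitrary word hangs off this cycle at the word obtained by replacing the
  prefix that ends in its last letter \<open>x \<notin> A\<close> by copies of the end of \<open>e\<close> on the side of \<open>x\<close>.
\<close>

primrec rev_pos :: "'a set \<Rightarrow> ('a \<Rightarrow> int) \<Rightarrow> 'a list \<Rightarrow> int" where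
  "rev_pos A f [] = 0"
| "rev_pos A f (x # r) =
     (if x \<in> A then f x * 2 ^ length r + rev_pos A f r else f x * (2 ^ Suc (length r) - 1))"

definition word_pos :: "'a set \<Rightarrow> ('a \<Rightarrow> int) \<Rightarrow> 'a list \<Rightarrow> int" where
  "word_pos A f w = rev_pos A f (rev w)"

lemma word_pos_Nil [simp]: "word_pos A f [] = 0"
  by (simp add: word_pos_def)

lemma word_pos_snoc:
  "word_pos A f (w @ [x]) =
     (if x \<in> A then f x * 2 ^ length w + word_pos A f w else f x * (2 ^ Suc (length w) - 1))"
  by (simp add: word_pos_def)

lemma word_pos_bounds:
  assumes "\<And>x. f x \<in> {0, 1::int}"
  shows "word_pos A f w \<in> {0..<2 ^ length w}"
proof (induction w rule: rev_induct)
  case (snoc x w)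
  then show ?case using assms[of x] by (auto simp: word_pos_snoc)
qed simp

text \<open>The recursion starts from the last letter, so a prefix enters only through its length
  and its own position.\<close>

lemma word_pos_append_cong:
  assumes "word_pos A f p = word_pos A f q" "length p = length q"
  shows "word_pos A f (p @ v) = word_pos A f (q @ v)"
proof (induction v rule: rev_induct)
  case (snoc x v)
  then show ?case
    using assms word_pos_snoc[of A f "p @ v" x] word_pos_snoc[of A f "q @ v" x] by simp
qed (use assms in simp)

text \<open>Over \<open>A\<close> the number can also be read from its least significant digit, the
  end at which \<open>edge_act\<close> works.\<close>

lemma word_pos_Cons:
  assumes "set (x # p) \<subseteq> A"
  shows "word_pos A f (x # p) = f x + 2 * word_pos A f p"
  using assms
proof (induction p rule: rev_induct)
  case Nil
  then show ?case using word_pos_snoc[of A f "[]" x] by simp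
next
  case (snoc y p)
  then show ?case using word_pos_snoc[of A f "x # p" y] word_pos_snoc[of A f p y] by simp
qed

lemma word_pos_edge_act:
  assumes "set p \<subseteq> {s, t}" "f s = 1" "f t = 0"
  shows "word_pos {s, t} f (edge_act (s, t) p) = circ_succ (2 ^ length p) (word_pos {s, t} f p)"
  using assms
proof (induction p)
  case Nil
  then show ?case by (simp add: circ_succ_def)
next
  case (Cons x p)
  have "set (edge_act (s, t) p) \<subseteq> {s, t}"
    using set_edge_act[of s t p] Cons.prems by auto
  then show ?case
    using Cons by (auto simp: word_pos_Cons circ_succ_def split: if_splits)
qed

lemma word_pos_const:
  assumes "\<And>x. x \<in> set p \<Longrightarrow> f x = c"
  shows "word_pos A f p = c * (2 ^ length p - 1)"
  using assms
proof (induction p rule: rev_induct)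
  case (snoc x p)
  then show ?case by (simp add: word_pos_snoc algebra_simps)
qed simp

text \<open>The numbers 0 and \<open>2 ^ length p - 1\<close> have only one binary expansion of this
  length, with all digits equal.\<close>

lemma word_pos_extremeD:
  assumes "set p \<subseteq> A" "\<And>x. f x \<in> {0, 1}" "c \<in> {0, 1}" "word_pos A f p = c * (2 ^ length p - 1)" "x \<in> set p"
  shows "f x = c"
  using assms(1,4,5)
proof (induction p)
  case (Cons y p)
  have b: "word_pos A f p \<in> {0..<2 ^ length p}" using word_pos_bounds[of f] assms(2) by blast
  have eq: "f y + 2 * word_pos A f p = c * (2 * 2 ^ length p - 1)"
    using Cons.prems by (simp add: word_pos_Cons)
  have "f y = c \<and> word_pos A f p = c * (2 ^ length p - 1)"
    using eq b assms(2)[of y] assms(3) by (auto simp: algebra_simps)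
  then show ?case using Cons by auto
qed simp

text \<open>
  The cycle with label \<open>e\<close> and common suffix \<open>\<tau>\<close> consists of the words \<open>p @ \<tau>\<close> with \<open>p\<close> over the
  two ends \<open>A\<close> of \<open>e\<close>.  Every word without suffix \<open>\<tau>\<close> hangs off this cycle at the constant word
  given by the side \<open>f (hd \<tau>)\<close> of \<open>e\<close> on which the first letter of \<open>\<tau>\<close> lies.
\<close>

definition cycle_pos :: "'a set \<Rightarrow> ('a \<Rightarrow> int) \<Rightarrow> 'a list \<Rightarrow> 'a list \<Rightarrow> int" where
  "cycle_pos A f \<tau> w =
     (if suffix \<tau> w then word_pos A f (take (length w - length \<tau>) w)
      else f (hd \<tau>) * (2 ^ (length w - length \<tau>) - 1))"

lemma cycle_pos_Nil [simp]: "cycle_pos A f [] w = word_pos A f w"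
  by (simp add: cycle_pos_def)

lemma cycle_pos_append [simp]: "cycle_pos A f \<tau> (p @ \<tau>) = word_pos A f p"
  by (simp add: cycle_pos_def suffixI)

lemma cycle_pos_not_suffix:
  "\<not> suffix \<tau> w \<Longrightarrow> cycle_pos A f \<tau> w = f (hd \<tau>) * (2 ^ (length w - length \<tau>) - 1)"
  by (simp add: cycle_pos_def)

lemma cycle_pos_append_append:
  assumes "\<tau> \<noteq> []"
  shows "cycle_pos A f (\<tau> @ v) (w @ v) = cycle_pos A f \<tau> w"
  using assms by (auto simp: cycle_pos_def)

lemma cycle_pos_bounds:
  assumes "\<And>x. f x \<in> {0, 1::int}"
  shows "cycle_pos A f \<tau> w \<in> {0..<2 ^ (length w - length \<tau>)}"
proof (cases "suffix \<tau> w")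
  case True
  then obtain p where "w = p @ \<tau>" by (auto simp: suffix_def)
  then show ?thesis using word_pos_bounds[of f A p] assms by simp
next
  case False
  then show ?thesis using assms[of "hd \<tau>"] by (auto simp: cycle_pos_not_suffix)
qed

text \<open>This makes an edge with both ends on one side invisible to the cycle: a block of letters
  from one side counts like a constant word.\<close>

lemma cycle_pos_replace_prefix:
  assumes pq: "set p \<subseteq> B" "set q \<subseteq> B" "length p = length q" and f: "\<And>x. x \<in> B \<Longrightarrow> f x = c"
  shows "cycle_pos A f \<tau> (p @ v) = cycle_pos A f \<tau> (q @ v)"
proof (cases "suffix \<tau> v")
  case True
  then obtain v' where v: "v = v' @ \<tau>" by (auto simp: suffix_def)
  have "word_pos A f p = c * (2 ^ length p - 1)" "word_pos A f q = c * (2 ^ length q - 1)"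
    using pq f by (intro word_pos_const; blast)+
  then have "word_pos A f (p @ v') = word_pos A f (q @ v')"
    using pq by (intro word_pos_append_cong) auto
  then show ?thesis
    using cycle_pos_append[of A f \<tau> "p @ v'"] cycle_pos_append[of A f \<tau> "q @ v'"] v by simp
next
  case False
  \<comment> \<open>If \<open>\<tau>\<close> reaches into \<open>r\<close>, its first letter lies in
    \<open>B\<close>, so the position computed on the cycle coincides with the default value for
    words off the cycle.\<close>
  have *: "cycle_pos A f \<tau> (r @ v) = f (hd \<tau>) * (2 ^ (length r + length v - length \<tau>) - 1)"
    if r: "set r \<subseteq> B" for r
  proof (cases "suffix \<tau> (r @ v)")
    case True
    with False obtain r2 where r2: "\<tau> = r2 @ v" "suffix r2 r"
      by (auto simp: suffix_append)
    then obtain r1 where r1: "r = r1 @ r2" by (auto simp: suffix_def)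
    have "r2 \<noteq> []" using False r2 by auto
    then have "f (hd \<tau>) = c" using r r1 r2 f by (cases r2) auto
    moreover have "word_pos A f r1 = c * (2 ^ length r1 - 1)"
      using r r1 f by (intro word_pos_const) auto
    ultimately show ?thesis using cycle_pos_append[of A f \<tau> r1] r1 r2 by simp
  qed (simp add: cycle_pos_not_suffix)
  show ?thesis using *[of p] *[of q] pq by simp
qed

lemma edge_act_takeWhile_dropWhile:
  fixes w :: "'a list" and s t :: 'a
  defines "P \<equiv> \<lambda>x. x \<in> {s, t}"
  shows "edge_act (s, t) w = edge_act (s, t) (takeWhile P w) @ dropWhile P w"
proof -
  have "dropWhile P w = [] \<or> hd (dropWhile P w) \<notin> {s, t}"
    using hd_dropWhile[of P w] by (auto simp: P_def)
  from edge_act_append[OF this, of "takeWhile P w"] show ?thesis by simp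
qed

lemma set_edge_act_takeWhile:
  "set (edge_act (s, t) (takeWhile (\<lambda>x. x \<in> {s, t}) w)) \<subseteq> {s, t}"
proof -
  have "set (takeWhile (\<lambda>x. x \<in> {s, t}) w) \<subseteq> {s, t}" by (auto dest: set_takeWhileD)
  then show ?thesis using set_edge_act[of s t "takeWhile (\<lambda>x. x \<in> {s, t}) w"] by blast
qed

lemma cycle_pos_edge_act_other:
  assumes "f s = f t"
  shows "cycle_pos A f \<tau> (edge_act (s, t) w) = cycle_pos A f \<tau> w"
proof -
  let ?p = "takeWhile (\<lambda>x. x \<in> {s, t}) w" and ?v = "dropWhile (\<lambda>x. x \<in> {s, t}) w"
  have "cycle_pos A f \<tau> (edge_act (s, t) ?p @ ?v) = cycle_pos A f \<tau> (?p @ ?v)"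
    using assms set_edge_act_takeWhile[of s t w]
    by (intro cycle_pos_replace_prefix[where B = "{s, t}" and c = "f t"]) (auto dest: set_takeWhileD)
  then show ?thesis by (simp only: edge_act_takeWhile_dropWhile[symmetric] takeWhile_dropWhile_id)
qed

lemma dropWhile_edge_act:
  "dropWhile (\<lambda>x. x \<in> {s, t}) (edge_act (s, t) w) = dropWhile (\<lambda>x. x \<in> {s, t}) w"
proof -
  let ?P = "\<lambda>x. x \<in> {s, t}"
  have "dropWhile ?P (edge_act (s, t) (takeWhile ?P w) @ dropWhile ?P w) = dropWhile ?P (dropWhile ?P w)"
    using set_edge_act_takeWhile[of s t w] by (intro dropWhile_append2) blast
  then show ?thesis by (simp only: edge_act_takeWhile_dropWhile[symmetric] dropWhile_idem)
qed

lemma cycle_pos_edge_act_own: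
  fixes w :: "'a list" and s t :: 'a
  assumes "f s = 1" "f t = 0"
  defines "\<tau> \<equiv> dropWhile (\<lambda>x. x \<in> {s, t}) w"
  shows "cycle_pos {s, t} f \<tau> (edge_act (s, t) w) =
    circ_succ (2 ^ (length w - length \<tau>)) (cycle_pos {s, t} f \<tau> w)"
proof -
  define p where "p = takeWhile (\<lambda>x. x \<in> {s, t}) w"
  have w: "w = p @ \<tau>" by (simp add: p_def \<tau>_def)
  have "edge_act (s, t) w = edge_act (s, t) p @ \<tau>"
    unfolding p_def \<tau>_def by (rule edge_act_takeWhile_dropWhile)
  moreover have "set p \<subseteq> {s, t}" by (auto simp: p_def dest: set_takeWhileD)
  ultimately show ?thesis using assms(1,2) w by (simp add: word_pos_edge_act)
qed

lemma word_pos_prefix_irrelevant: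
  assumes "length p = length q" "z \<notin> A"
  shows "word_pos A f (p @ z # v) = word_pos A f (q @ z # v)"
proof -
  have "word_pos A f (p @ [z]) = word_pos A f (q @ [z])" using assms by (simp add: word_pos_snoc)
  from word_pos_append_cong[OF this, of v] show ?thesis using assms by simp
qed

text \<open>A word moves only on the \<open>(s, t)\<close>-cycle through it. For another suffix,
  either the action changes only letters before some letter outside \<open>{s, t}\<close>, which the
  position ignores, or the word hangs off the cycle both before and after.\<close>

lemma cycle_pos_edge_act_same_label:
  assumes \<tau>: "\<tau> = [] \<or> hd \<tau> \<notin> {s, t}" and ne: "\<tau> \<noteq> dropWhile (\<lambda>x. x \<in> {s, t}) w"
  shows "cycle_pos {s, t} f \<tau> (edge_act (s, t) w) = cycle_pos {s, t} f \<tau> w"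
proof -
  let ?P = "\<lambda>x. x \<in> {s, t}"
  show ?thesis
  proof (cases "suffix \<tau> w")
    case True
    then obtain p where w: "w = p @ \<tau>" by (auto simp: suffix_def)
    have act: "edge_act (s, t) w = edge_act (s, t) p @ \<tau>" using \<tau> w by (simp add: edge_act_append)
    have "\<not> set p \<subseteq> {s, t}"
    proof
      assume "set p \<subseteq> {s, t}"
      then have "dropWhile ?P w = dropWhile ?P \<tau>" unfolding w by (intro dropWhile_append2) blast
      also have "\<dots> = \<tau>" using \<tau> by (cases \<tau>) auto
      finally show False using ne by simp
    qed
    then have "dropWhile ?P p \<noteq> []" by auto
    then obtain z v where zv: "dropWhile ?P p = z # v" "z \<notin> {s, t}"
      by (metis hd_dropWhile list.exhaust_sel)
    have "edge_act (s, t) p = edge_act (s, t) (takeWhile ?P p) @ z # v"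
      using edge_act_takeWhile_dropWhile[of s t p] zv by simp
    moreover have "p = takeWhile ?P p @ z # v" using zv by (metis takeWhile_dropWhile_id)
    ultimately have "word_pos {s, t} f (edge_act (s, t) p) = word_pos {s, t} f p"
      using word_pos_prefix_irrelevant zv(2) length_edge_act by metis
    then show ?thesis using w act by simp
  next
    case False
    \<comment> \<open>A new suffix \<open>\<tau>\<close> would have to begin inside the rewritten
      block, hence with a letter of \<open>{s, t}\<close>.\<close>
    have "\<not> suffix \<tau> (edge_act (s, t) w)"
    proof
      assume "suffix \<tau> (edge_act (s, t) w)"
      then have "suffix \<tau> (edge_act (s, t) (takeWhile ?P w) @ dropWhile ?P w)"
        by (simp only: edge_act_takeWhile_dropWhile[symmetric])
      moreover have "\<not> suffix \<tau> (dropWhile ?P w)"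
        using False by (meson suffix_dropWhile suffix_order.trans)
      ultimately obtain r where r: "\<tau> = r @ dropWhile ?P w" "suffix r (edge_act (s, t) (takeWhile ?P w))"
        by (auto simp: suffix_append)
      then have "r \<noteq> []" "set r \<subseteq> {s, t}"
        using ne set_edge_act_takeWhile[of s t w] set_mono_suffix by fastforce+
      then show False using \<tau> r(1) by (cases r) auto
    qed
    then show ?thesis using False by (simp add: cycle_pos_not_suffix)
  qed
qed

section \<open>Sides of the edges of a tree\<close>

abbreviation (input) adj_rel :: "('a \<times> 'a) set \<Rightarrow> ('a \<times> 'a) set" where
  "adj_rel E \<equiv> {(x, y). adj E x y}"

abbreviation ends :: "'a \<times> 'a \<Rightarrow> 'a set" where
  "ends e \<equiv> {fst e, snd e}"

lemma rtrancl_distinct_path: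
  assumes "(x, y) \<in> R\<^sup>*"
  obtains p where "p \<noteq> []" "hd p = x" "last p = y" "distinct p"
    "\<And>i. Suc i < length p \<Longrightarrow> (p ! i, p ! Suc i) \<in> R"
proof -
  have "\<exists>p. p \<noteq> [] \<and> hd p = x \<and> last p = y \<and> distinct p \<and>
          (\<forall>i. Suc i < length p \<longrightarrow> (p ! i, p ! Suc i) \<in> R)"
    using assms
  proof (induction rule: rtrancl_induct)
    case base
    then show ?case by (intro exI[of _ "[x]"]) auto
  next
    case (step y z)
    then obtain p where p: "p \<noteq> []" "hd p = x" "last p = y" "distinct p"
      "\<And>i. Suc i < length p \<Longrightarrow> (p ! i, p ! Suc i) \<in> R" by blast
    show ?case
    proof (cases "z \<in> set p")
      case True
      then obtain j where j: "j < length p" "p ! j = z" by (auto simp: in_set_conv_nth)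
      have "last (take (Suc j) p) = z" using j by (simp add: take_Suc_conv_app_nth)
      then show ?thesis using p j by (intro exI[of _ "take (Suc j) p"]) auto
    next
      case False
      have "((p @ [z]) ! i, (p @ [z]) ! Suc i) \<in> R" if "i < length p" for i
      proof (cases "Suc i < length p")
        case True
        then show ?thesis using p(5)[of i] by (simp add: nth_append)
      next
        case False
        then have "Suc i = length p" using that by simp
        then have "p ! i = y" using p(1,3) by (metis diff_Suc_1 last_conv_nth)
        then show ?thesis using \<open>Suc i = length p\<close> step.hyps that by (simp add: nth_append)
      qed
      then have "\<forall>i. Suc i < length (p @ [z]) \<longrightarrow> ((p @ [z]) ! i, (p @ [z]) ! Suc i) \<in> R" by simp
      then show ?thesis using p(1-4) False by (intro exI[of _ "p @ [z]"]) simp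
    qed
  qed
  then show thesis by (elim exE conjE) (rule that, auto)
qed

text \<open>Integer values let the side double as the binary digit \<open>f\<close> of the
  positions, with \<open>fst e\<close> carrying 1.\<close>

definition side :: "('a \<times> 'a) set \<Rightarrow> 'a \<times> 'a \<Rightarrow> 'a \<Rightarrow> int" where
  "side E e x = (if (fst e, x) \<in> (adj_rel (E - {e}))\<^sup>* then 1 else 0)"

lemma side_in: "side E e x \<in> {0, 1}"
  by (simp add: side_def)

locale tree_graph =
  fixes V :: "'a set" and E :: "('a \<times> 'a) set"
  assumes tree: "oriented_tree V E"
begin

lemma finite_V: "finite V" and V_nonempty: "V \<noteq> {}" and E_subset: "E \<subseteq> V \<times> V"
  using tree by (auto simp: oriented_tree_def)

lemma finite_E: "finite E"
  using E_subset finite_V by (metis finite_cartesian_product finite_subset)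

lemma edge_neq: "(s, t) \<in> E \<Longrightarrow> s \<noteq> t" and edge_asym: "(s, t) \<in> E \<Longrightarrow> (t, s) \<notin> E"
  using tree by (auto simp: oriented_tree_def)

lemma side_fst: "side E e (fst e) = 1"
  by (simp add: side_def)

text \<open>A path from \<open>s\<close> to \<open>t\<close> avoiding \<open>e\<close> would be
  closed by \<open>e\<close> to a cycle. Acyclicity of the tree enters here.\<close>

lemma side_snd:
  assumes "e \<in> E"
  shows "side E e (snd e) = 0"
proof (rule ccontr)
  obtain s t where e: "e = (s, t)" by (cases e)
  let ?R = "adj_rel (E - {e})"
  assume "side E e (snd e) \<noteq> 0"
  then have "(s, t) \<in> ?R\<^sup>*" using e by (auto simp: side_def split: if_splits)
  then obtain p where p: "p \<noteq> []" "hd p = s" "last p = t" "distinct p"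
    and step: "\<And>i. Suc i < length p \<Longrightarrow> (p ! i, p ! Suc i) \<in> ?R"
    using rtrancl_distinct_path by metis
  have st: "s \<noteq> t" "(t, s) \<notin> E" using assms e edge_neq edge_asym by auto
  have p0: "p ! 0 = s" and pl: "p ! (length p - 1) = t"
    using p by (auto simp: hd_conv_nth last_conv_nth)
  have "length p \<noteq> 1" using p0 pl st by auto
  moreover have "length p \<noteq> 2"
  proof
    assume "length p = 2"
    then have "(s, t) \<in> ?R" using step[of 0] p0 pl by (simp add: numeral_2_eq_2)
    then show False using st e by (auto simp: adj_def)
  qed
  ultimately have len: "length p \<ge> 3" using p(1) by (cases p; cases "tl p"; cases "tl (tl p)") auto
  have "is_cycle E p"
    unfolding is_cycle_def
  proof (intro conjI allI impI)
    fix i assume i: "i < length p"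
    show "adj E (p ! i) (p ! ((i + 1) mod length p))"
    proof (cases "Suc i < length p")
      case True
      then show ?thesis using step[of i] by (auto simp: adj_def)
    next
      case False
      then have "i = length p - 1" "i + 1 = length p" using i by auto
      then show ?thesis using p0 pl assms e by (simp add: adj_def)
    qed
  qed (use len p in auto)
  moreover have "set p \<subseteq> V"
  proof
    fix x assume "x \<in> set p"
    then obtain i where i: "i < length p" "p ! i = x" by (auto simp: in_set_conv_nth)
    with \<open>is_cycle E p\<close> have "adj E x (p ! ((i + 1) mod length p))" by (auto simp: is_cycle_def)
    then show "x \<in> V" using E_subset by (auto simp: adj_def)
  qed
  ultimately show False using tree by (auto simp: oriented_tree_def)
qed

lemma side_adj:
  assumes "adj (E - {e}) x y"
  shows "side E e x = side E e y"
proof -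
  have "(x, y) \<in> adj_rel (E - {e})" "(y, x) \<in> adj_rel (E - {e})"
    using assms by (auto simp: adj_def)
  then show ?thesis unfolding side_def by (meson rtrancl.rtrancl_into_rtrancl)
qed

lemma side_other_edge:
  assumes "(s, t) \<in> E" "e \<noteq> (s, t)"
  shows "side E e s = side E e t"
  using assms by (intro side_adj) (auto simp: adj_def)

lemma side_inj_on_ends:
  assumes "e \<in> E" "x \<in> ends e" "y \<in> ends e" "side E e x = side E e y"
  shows "x = y"
  using assms side_fst[of e] side_snd[of e] by auto

text \<open>The edge is the first one on the way from \<open>c\<close> to \<open>d\<close>. As the
  walk grows outwards from \<open>c\<close>, a step that avoids \<open>c\<close> crosses no edge at
  \<open>c\<close>, so the separating edge found so far keeps separating.\<close>

lemma separating_edge: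
  assumes "c \<in> V" "d \<in> V" "c \<noteq> d"
  obtains e where "e \<in> E" "c \<in> ends e" "side E e c \<noteq> side E e d"
proof -
  have "(d, c) \<in> (adj_rel E)\<^sup>*" using tree assms by (auto simp: oriented_tree_def)
  then have "d = c \<or> (\<exists>e \<in> E. c \<in> ends e \<and> side E e c \<noteq> side E e d)"
  proof (induction rule: converse_rtrancl_induct)
    case (step x y)
    show ?case
    proof (cases "x = c")
      case x: False
      obtain e' where e': "e' \<in> E" "e' = (x, y) \<or> e' = (y, x)" using step.hyps by (auto simp: adj_def)
      show ?thesis
      proof (cases "y = c")
        case True
        then have "side E e' c \<noteq> side E e' x" using e' x side_inj_on_ends[of e' c x] by auto
        then show ?thesis using e' True by (intro disjI2 bexI[of _ e']) auto
      next
        case False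
        then obtain e where e: "e \<in> E" "c \<in> ends e" "side E e c \<noteq> side E e y" using step.IH by blast
        then have "e \<noteq> e'" using e' x False by auto
        then have "side E e x = side E e y" using e' by (intro side_adj) (auto simp: adj_def)
        then show ?thesis using e by auto
      qed
    qed simp
  qed simp
  then show thesis using that assms by blast
qed

text \<open>A walk from \<open>c\<close> is never beyond both edges at once, because each is crossed
  only on the near side of the other.\<close>

lemma separating_edge_unique:
  assumes "e \<in> E" "e' \<in> E" "c \<in> ends e" "c \<in> ends e'" "d \<in> V"
    and "side E e c \<noteq> side E e d" "side E e' c \<noteq> side E e' d"
  shows "e = e'"
proof (rule ccontr)
  assume ne: "e \<noteq> e'"
  have "c \<in> V" using assms E_subset by auto
  then have "(c, d) \<in> (adj_rel E)\<^sup>*" using tree assms by (auto simp: oriented_tree_def)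
  then have "side E e c = side E e d \<or> side E e' c = side E e' d"
  proof (induction rule: rtrancl_induct)
    case (step y z)
    obtain g where g: "g \<in> E" "g = (y, z) \<or> g = (z, y)" using step.hyps by (auto simp: adj_def)
    have invariant: "side E h y = side E h z" if "h \<noteq> g" for h
      using g that by (intro side_adj) (auto simp: adj_def)
    show ?case
    proof (cases "g = e \<or> g = e'")
      case True
      \<comment> \<open>A step along \<open>e\<close> ends on the same side of \<open>e'\<close> as \<open>c\<close>, and conversely.\<close>
      have "side E e' (fst e) = side E e' (snd e)" "side E e (fst e') = side E e (snd e')"
        using side_other_edge[of "fst e" "snd e" e'] side_other_edge[of "fst e'" "snd e'" e] assms ne by auto
      then have "side E e' x = side E e' c" if "x \<in> ends e" for x
        using that assms by auto
      moreover have "side E e x = side E e c" if "x \<in> ends e'" for x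
        using that assms \<open>side E e (fst e') = side E e (snd e')\<close> by auto
      ultimately show ?thesis using True g by auto
    next
      case False
      then show ?thesis using step.IH invariant[of e] invariant[of e'] by metis
    qed
  qed simp
  then show False using assms by blast
qed

text \<open>Rooted at \<open>r\<close>, an edge corresponds to its end away from \<open>r\<close>;
  existence and uniqueness of separating edges make this a bijection onto the other
  vertices.\<close>

lemma card_edges: "card E + 1 = card V"
proof -
  obtain r where r: "r \<in> V" using V_nonempty by blast
  define away where "away e = (if side E e (fst e) = side E e r then snd e else fst e)" for e
  have away: "away e \<in> ends e \<and> side E e (away e) \<noteq> side E e r" if "e \<in> E" for e
    using side_fst[of e] side_snd[of e] that by (auto simp: away_def)
  have "bij_betw away E (V - {r})"
    unfolding bij_betw_def
  proof
    show "inj_on away E"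
      using away separating_edge_unique r by (intro inj_onI) metis
    show "away ` E = V - {r}"
    proof (intro equalityI subsetI)
      fix x assume "x \<in> away ` E"
      then show "x \<in> V - {r}" using away E_subset by fastforce
    next
      fix x assume x: "x \<in> V - {r}"
      then obtain e where e: "e \<in> E" "x \<in> ends e" "side E e x \<noteq> side E e r"
        using separating_edge[of x r] r by auto
      have "side E e x = side E e (away e)"
        using side_in[of E e x] side_in[of E e r] side_in[of E e "away e"] e away[of e] by auto
      then have "x = away e" using side_inj_on_ends e away by blast
      then show "x \<in> away ` E" using e by blast
    qed
  qed
  then have "card E = card (V - {r})" by (rule bij_betw_same_card)
  then show ?thesis using r finite_V by (simp add: card_gt_0_iff) (metis Suc_pred card_gt_0_iff empty_iff)
qed

definition side_card :: "'a \<times> 'a \<Rightarrow> int \<Rightarrow> int" where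
  "side_card e c = int (card {x \<in> V. side E e x = c})"

lemma side_card_add: "side_card e 1 + side_card e 0 = int (card V)"
proof -
  have "{x \<in> V. side E e x = 1} \<union> {x \<in> V. side E e x = 0} = V" using side_in[of E e] by auto
  moreover have "{x \<in> V. side E e x = 1} \<inter> {x \<in> V. side E e x = 0} = {}" by auto
  ultimately show ?thesis
    using card_Un_disjoint[of "{x \<in> V. side E e x = 1}" "{x \<in> V. side E e x = 0}"] finite_V
    by (auto simp: side_card_def)
qed

text \<open>Each side contains exactly one end of \<open>e\<close>. The ends act as binary digits
  and are treated apart; all further letters of a side behave alike.\<close>

lemma sum_over_sides:
  assumes e: "e \<in> E" and g: "\<And>x. x \<in> V \<Longrightarrow> x \<notin> ends e \<Longrightarrow> g x = G (side E e x)"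
  shows "(\<Sum>x\<in>V. g x) = g (fst e) + g (snd e)
    + (side_card e 1 - 1) * G 1 + (side_card e 0 - 1) * (G 0 :: int)"
proof -
  have ends: "fst e \<in> V" "snd e \<in> V" "fst e \<noteq> snd e" 
    using e E_subset edge_neq[of "fst e" "snd e"] by auto
  let ?S = "\<lambda>c. {x \<in> V. side E e x = c}"
  have V: "V = ?S 1 \<union> ?S 0" using side_in[of E e] by auto
  have "(\<Sum>x\<in>V. g x) = sum g (?S 1) + sum g (?S 0)"
    by (subst V, rule sum.union_disjoint) (use finite_V in auto)
  moreover have part: "sum g (?S c) = g x + (side_card e c - 1) * G c"
    if x: "x \<in> ends e" "side E e x = c" for x c
  proof -
    have xS: "x \<in> ?S c" using x ends by auto
    have fin: "finite (?S c)" using finite_V by simp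
    have "g y = G c" if y: "y \<in> ?S c - {x}" for y
    proof -
      have "y \<notin> ends e" using side_inj_on_ends[OF e x(1), of y] x(2) y by blast
      then show ?thesis using g[of y] y by simp
    qed
    then have "sum g (?S c - {x}) = (\<Sum>y\<in>?S c - {x}. G c)" by (rule sum.cong[OF refl])
    also have "\<dots> = int (card (?S c - {x})) * G c" by simp
    also have "int (card (?S c - {x})) = side_card e c - 1"
      using card.remove[OF fin xS] by (simp add: side_card_def)
    finally show ?thesis using sum.remove[OF _ xS, of g] finite_V by simp
  qed
  ultimately show ?thesis
    using part[of "fst e" 1] part[of "snd e" 0] side_fst[of e] side_snd[OF e] by simp
qed

section \<open>Distances and Wiener index of the tree\<close>

text \<open>Crossing an edge changes only its own summand, and \<open>separating_edge\<close>
  supplies a crossing towards the target.\<close>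

lemma gdist_tree:
  assumes "x \<in> V" "y \<in> V"
  shows "int (gdist (adj_rel E) x y) = (\<Sum>e\<in>E. \<bar>side E e x - side E e y\<bar>)"
proof (rule int_gdist_eqI[where X = V and D = "\<lambda>x y. \<Sum>e\<in>E. \<bar>side E e x - side E e y\<bar>"])
  have move: "(\<Sum>e\<in>E. \<bar>side E e u - side E e v\<bar>) - (\<Sum>e\<in>E. \<bar>side E e u' - side E e v\<bar>) =
      \<bar>side E e u - side E e v\<bar> - \<bar>side E e u' - side E e v\<bar>"
    if e: "e \<in> E" "e = (u, u') \<or> e = (u', u)" for e u u' v
  proof -
    have "side E e' u = side E e' u'" if "e' \<in> E - {e}" for e'
      using e that by (intro side_adj) (auto simp: adj_def)
    then show ?thesis
      using sum.remove[OF finite_E e(1), of "\<lambda>e. \<bar>side E e u - side E e v\<bar>"]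
        sum.remove[OF finite_E e(1), of "\<lambda>e. \<bar>side E e u' - side E e v\<bar>"] by simp
  qed
  show "u' \<in> V \<and> (\<Sum>e\<in>E. \<bar>side E e u - side E e v\<bar>) \<le> (\<Sum>e\<in>E. \<bar>side E e u' - side E e v\<bar>) + 1"
    if uu': "(u, u') \<in> adj_rel E" for u u' v
  proof -
    obtain e where e: "e \<in> E" "e = (u, u') \<or> e = (u', u)" using uu' by (auto simp: adj_def)
    show ?thesis using move[OF e, of v] side_in[of E e u] side_in[of E e u'] side_in[of E e v] e E_subset by auto
  qed
  show "\<exists>u'. (u, u') \<in> adj_rel E \<and>
      (\<Sum>e\<in>E. \<bar>side E e u' - side E e v\<bar>) < (\<Sum>e\<in>E. \<bar>side E e u - side E e v\<bar>)"
    if uv: "u \<in> V" "v \<in> V" "u \<noteq> v" for u v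
  proof -
    obtain e where e: "e \<in> E" "u \<in> ends e" "side E e u \<noteq> side E e v"
      using separating_edge[OF uv] by blast
    then obtain u' where u': "e = (u, u') \<or> e = (u', u)" by (metis insertE prod.collapse singletonD)
    then have "side E e u \<noteq> side E e u'" using side_fst[of e] side_snd[OF e(1)] by auto
    then have "side E e u' = side E e v"
      using e side_in[of E e u] side_in[of E e u'] side_in[of E e v] by auto
    then show ?thesis using move[OF e(1) u', of v] e u' by (intro exI[of _ u']) (auto simp: adj_def)
  qed
qed (use assms in \<open>auto intro: sum_nonneg\<close>)

text \<open>After exchanging sums, each edge separates
  \<open>2 * (side_card e 1 * side_card e 0)\<close> ordered pairs; the halving in
  \<open>wiener\<close> removes the factor.\<close>

lemma wiener_tree: "wiener V (adj_rel E) = (\<Sum>e\<in>E. of_int (side_card e 1 * side_card e 0))"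
proof -
  have edge: "(\<Sum>x\<in>V. \<Sum>y\<in>V. \<bar>side E e x - side E e y\<bar>) = 2 * (side_card e 1 * side_card e 0)"
    if e: "e \<in> E" for e
  proof -
    have "(\<Sum>y\<in>V. \<bar>side E e x - side E e y\<bar>) =
        side_card e 1 * \<bar>side E e x - 1\<bar> + side_card e 0 * \<bar>side E e x\<bar>" for x
      using sum_over_sides[OF e, of "\<lambda>y. \<bar>side E e x - side E e y\<bar>" "\<lambda>c. \<bar>side E e x - c\<bar>"]
        side_fst[of e] side_snd[OF e] by (simp add: algebra_simps)
    then have "(\<Sum>x\<in>V. \<Sum>y\<in>V. \<bar>side E e x - side E e y\<bar>) =
        (\<Sum>x\<in>V. side_card e 1 * \<bar>side E e x - 1\<bar> + side_card e 0 * \<bar>side E e x\<bar>)" by simp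
    then show ?thesis
      using sum_over_sides[OF e, of "\<lambda>x. side_card e 1 * \<bar>side E e x - 1\<bar> + side_card e 0 * \<bar>side E e x\<bar>"
          "\<lambda>c. side_card e 1 * \<bar>c - 1\<bar> + side_card e 0 * \<bar>c\<bar>"]
        side_fst[of e] side_snd[OF e] by (simp add: algebra_simps)
  qed
  have "(\<Sum>x\<in>V. \<Sum>y\<in>V. int (gdist (adj_rel E) x y)) = (\<Sum>x\<in>V. \<Sum>y\<in>V. \<Sum>e\<in>E. \<bar>side E e x - side E e y\<bar>)"
    by (intro sum.cong gdist_tree) auto
  also have "\<dots> = (\<Sum>x\<in>V. \<Sum>e\<in>E. \<Sum>y\<in>V. \<bar>side E e x - side E e y\<bar>)"
    by (intro sum.cong sum.swap refl)
  also have "\<dots> = (\<Sum>e\<in>E. \<Sum>x\<in>V. \<Sum>y\<in>V. \<bar>side E e x - side E e y\<bar>)"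
    by (rule sum.swap)
  also have "\<dots> = 2 * (\<Sum>e\<in>E. side_card e 1 * side_card e 0)"
    unfolding sum_distrib_left by (intro sum.cong refl edge)
  finally have "real_of_int (\<Sum>x\<in>V. \<Sum>y\<in>V. int (gdist (adj_rel E) x y)) =
      real_of_int (2 * (\<Sum>e\<in>E. side_card e 1 * side_card e 0))" by (rule arg_cong)
  then show ?thesis by (simp add: wiener_def)
qed

end

section \<open>Distances as sums over cycles\<close>

text \<open>It allows a common suffix to be stripped. One more letter \<open>z\<close> adds the same
  top digit to both positions, or starts the suffix of the cycle, or lengthens it; in no case do the
  positions become equal.\<close>

lemma cycle_pos_neq_append:
  assumes ne: "cycle_pos A f (dropWhile (\<lambda>x. x \<in> A) u) u \<noteq> cycle_pos A f (dropWhile (\<lambda>x. x \<in> A) u) v"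
    and len: "length u = length v"
  shows "cycle_pos A f (dropWhile (\<lambda>x. x \<in> A) (u @ \<sigma>)) (u @ \<sigma>)
       \<noteq> cycle_pos A f (dropWhile (\<lambda>x. x \<in> A) (u @ \<sigma>)) (v @ \<sigma>)"
  using ne len
proof (induction \<sigma> arbitrary: u v)
  case (Cons z \<sigma>)
  let ?P = "\<lambda>x. x \<in> A"
  have "cycle_pos A f (dropWhile ?P (u @ [z])) (u @ [z]) \<noteq> cycle_pos A f (dropWhile ?P (u @ [z])) (v @ [z])"
  proof (cases "dropWhile ?P u = []")
    case True
    then have u: "set u \<subseteq> A" by auto
    have ne: "word_pos A f u \<noteq> word_pos A f v" using Cons.prems(1) unfolding True by simp
    have drop: "dropWhile ?P (u @ [z]) = dropWhile ?P [z]" using u by (intro dropWhile_append2) auto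
    show ?thesis
      unfolding drop using ne Cons.prems(2) cycle_pos_append[of A f "[z]"]
      by (cases "z \<in> A") (simp_all add: word_pos_snoc)
  next
    case False
    then have "dropWhile ?P (u @ [z]) = dropWhile ?P u @ [z]" by (auto simp: dropWhile_append)
    then show ?thesis using Cons.prems(1) False by (simp add: cycle_pos_append_append)
  qed
  from Cons.IH[OF this] Cons.prems(2) show ?case by simp
qed simp

context tree_graph
begin

abbreviation label_pos :: "'a \<times> 'a \<Rightarrow> 'a list \<Rightarrow> 'a list \<Rightarrow> int" where
  "label_pos e \<equiv> cycle_pos (ends e) (side E e)"

abbreviation own_suffix :: "'a \<times> 'a \<Rightarrow> 'a list \<Rightarrow> 'a list" where
  "own_suffix e w \<equiv> dropWhile (\<lambda>x. x \<in> ends e) w"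

text \<open>The condition on the first letter makes \<open>\<tau>\<close> begin where the varying
  block ends, so each cycle is listed once. Suffixes of length \<open>n\<close> give loops, which
  contribute 0.\<close>

definition cycle_index :: "nat \<Rightarrow> (('a \<times> 'a) \<times> 'a list) set" where
  "cycle_index n = {(e, \<tau>). e \<in> E \<and> set \<tau> \<subseteq> V \<and> length \<tau> \<le> n \<and> (\<tau> = [] \<or> hd \<tau> \<notin> ends e)}"

definition cactus_dist :: "nat \<Rightarrow> 'a list \<Rightarrow> 'a list \<Rightarrow> int" where
  "cactus_dist n u v = (\<Sum>(e, \<tau>) \<in> cycle_index n.
     circ_dist (2 ^ (n - length \<tau>)) (label_pos e \<tau> u) (label_pos e \<tau> v))"

lemma finite_cycle_index: "finite (cycle_index n)"
proof (rule finite_subset)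
  show "cycle_index n \<subseteq> E \<times> {\<tau>. set \<tau> \<subseteq> V \<and> length \<tau> \<le> n}" by (auto simp: cycle_index_def)
  show "finite (E \<times> {\<tau>. set \<tau> \<subseteq> V \<and> length \<tau> \<le> n})"
    using finite_E finite_lists_length_le[OF finite_V] by blast
qed

lemma label_pos_bounds:
  assumes "length w = n"
  shows "label_pos e \<tau> w \<in> {0..<2 ^ (n - length \<tau>)}"
  using cycle_pos_bounds[of "side E e", OF side_in] assms by blast

lemma own_suffix_index:
  assumes "e \<in> E" "u \<in> words V n"
  shows "(e, own_suffix e u) \<in> cycle_index n"
proof -
  have "own_suffix e u = [] \<or> hd (own_suffix e u) \<notin> ends e"
    using hd_dropWhile[of "\<lambda>x. x \<in> ends e" u] by auto
  moreover have "set (own_suffix e u) \<subseteq> V" using assms by (auto simp: words_def dest: set_dropWhileD)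
  ultimately show ?thesis
    using assms by (auto simp: cycle_index_def words_def length_dropWhile_le)
qed

lemma ends_subset: "e \<in> E \<Longrightarrow> ends e \<subseteq> V"
  using E_subset by auto

lemma edge_act_words:
  assumes "e \<in> E" "u \<in> words V n"
  shows "edge_act e u \<in> words V n"
  using assms set_edge_act[of "fst e" "snd e" u] ends_subset[of e] by (auto simp: words_def)

lemma edge_act_inverse_words:
  assumes "e \<in> E" "u \<in> words V n"
  shows "edge_act (snd e, fst e) u \<in> words V n" "edge_act e (edge_act (snd e, fst e) u) = u"
  using assms set_edge_act[of "snd e" "fst e" u] ends_subset[of e]
    edge_act_inverse[of "fst e" "snd e" u] edge_neq[of "fst e" "snd e"] by (auto simp: words_def)

text \<open>All summands but one are unchanged: other labels see both ends of \<open>e\<close> on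
  one side, and the other cycles labelled \<open>e\<close> do not pass through
  \<open>u\<close>.\<close>

lemma cactus_dist_edge_act:
  assumes e: "e \<in> E" and u: "u \<in> words V n"
  defines "\<tau> \<equiv> own_suffix e u"
  defines "N \<equiv> 2 ^ (n - length \<tau>)"
  shows "label_pos e \<tau> (edge_act e u) = circ_succ N (label_pos e \<tau> u)"
    and "cactus_dist n (edge_act e u) v - cactus_dist n u v =
      circ_dist N (circ_succ N (label_pos e \<tau> u)) (label_pos e \<tau> v)
      - circ_dist N (label_pos e \<tau> u) (label_pos e \<tau> v)"
proof -
  have lu: "length u = n" using u by (simp add: words_def)
  show own: "label_pos e \<tau> (edge_act e u) = circ_succ N (label_pos e \<tau> u)"
    using cycle_pos_edge_act_own[of "side E e" "fst e" "snd e" u] side_fst[of e] side_snd[OF e] lu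
    by (simp add: \<tau>_def N_def)
  have other: "label_pos e' \<tau>' (edge_act e u) = label_pos e' \<tau>' u"
    if i: "(e', \<tau>') \<in> cycle_index n - {(e, \<tau>)}" for e' \<tau>'
  proof (cases "e' = e")
    case True
    then show ?thesis
      using i cycle_pos_edge_act_same_label[of \<tau>' "fst e" "snd e" u "side E e"]
      by (auto simp: cycle_index_def \<tau>_def)
  next
    case False
    then have "side E e' (fst e) = side E e' (snd e)"
      using side_other_edge[of "fst e" "snd e" e'] e by auto
    from cycle_pos_edge_act_other[of "side E e'" "fst e" "snd e", OF this] show ?thesis by simp
  qed
  let ?g = "\<lambda>w (e, \<tau>). circ_dist (2 ^ (n - length \<tau>)) (label_pos e \<tau> w) (label_pos e \<tau> v)"
  have idx: "(e, \<tau>) \<in> cycle_index n" using own_suffix_index[OF e u] by (simp add: \<tau>_def)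
  have "sum (?g (edge_act e u)) (cycle_index n - {(e, \<tau>)}) = sum (?g u) (cycle_index n - {(e, \<tau>)})"
  proof (rule sum.cong[OF refl])
    fix i assume i: "i \<in> cycle_index n - {(e, \<tau>)}"
    obtain e' \<tau>' where "i = (e', \<tau>')" by (cases i)
    then show "?g (edge_act e u) i = ?g u i" using other[of e' \<tau>'] i by simp
  qed
  then show "cactus_dist n (edge_act e u) v - cactus_dist n u v =
      circ_dist N (circ_succ N (label_pos e \<tau> u)) (label_pos e \<tau> v)
      - circ_dist N (label_pos e \<tau> u) (label_pos e \<tau> v)"
    using sum.remove[OF finite_cycle_index idx, of "?g (edge_act e u)"]
      sum.remove[OF finite_cycle_index idx, of "?g u"] own
    by (simp add: cactus_dist_def N_def)
qed

text \<open>The edge is taken at the first letter \<open>c\<close> of \<open>u\<close>, towards the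
  next different letter. Then either \<open>v\<close> hangs off the cycle at a point other than
  \<open>u\<close>, or the two positions differ in the top digit.\<close>

lemma own_cycle_separates_last:
  assumes "u = a @ [x]" "v = b @ [y]" "length a = length b" "x \<noteq> y" "set u \<subseteq> V" "y \<in> V"
  shows "\<exists>e\<in>E. label_pos e (own_suffix e u) u \<noteq> label_pos e (own_suffix e u) v"
proof -
  define c where "c = hd u"
  \<comment> \<open>If \<open>u\<close> is constant there is no second letter; \<open>y\<close>
    takes its place and differs from \<open>x = c\<close>.\<close>
  define d where "d = (case dropWhile (\<lambda>z. z = c) u of [] \<Rightarrow> y | z # _ \<Rightarrow> z)"
  have cu: "c \<in> set u" using assms(1) by (cases a) (simp_all add: c_def)
  have d: "d \<noteq> c" "d \<in> V"
  proof -
    show "d \<noteq> c"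
    proof (cases "dropWhile (\<lambda>z. z = c) u")
      case Nil
      then have "x = c" using assms(1) by auto
      then show ?thesis unfolding d_def Nil using assms(4) by simp
    next
      case (Cons z zs)
      then have "z \<noteq> c" using hd_dropWhile[of "\<lambda>z. z = c" u] by auto
      then show ?thesis unfolding d_def Cons by simp
    qed
    have "set (dropWhile (\<lambda>z. z = c) u) \<subseteq> V" using assms(5) by (auto dest: set_dropWhileD)
    then show "d \<in> V" using assms(6) by (auto simp: d_def split: list.splits)
  qed
  then obtain e where e: "e \<in> E" "c \<in> ends e" "side E e c \<noteq> side E e d"
    using separating_edge[of c d] cu assms(5) by blast
  let ?f = "side E e" and ?A = "ends e"
  define p where "p = takeWhile (\<lambda>x. x \<in> ?A) u"
  define \<tau> where "\<tau> = own_suffix e u"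
  have u: "u = p @ \<tau>" by (simp add: p_def \<tau>_def)
  have pA: "set p \<subseteq> ?A" by (auto simp: p_def dest: set_takeWhileD)
  have cp: "c \<in> set p" using e(2) cu by (cases u) (auto simp: p_def c_def)
  \<comment> \<open>The initial copies of \<open>c\<close> belong to \<open>p\<close>, so the next
    different letter is in \<open>p\<close> or right after it, with \<open>y\<close> standing in
    when \<open>u\<close> is exhausted.\<close>
  have d_cases: "d \<in> set p \<or> d = (if \<tau> = [] then y else hd \<tau>)"
  proof (cases "set p \<subseteq> {c}")
    case True
    then have "dropWhile (\<lambda>z. z = c) u = dropWhile (\<lambda>z. z = c) \<tau>"
      unfolding u by (intro dropWhile_append2) auto
    also have "\<dots> = \<tau>"
      using e(2) hd_dropWhile[of "\<lambda>x. x \<in> ?A" u] unfolding \<tau>_def[symmetric] by (cases \<tau>) auto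
    finally show ?thesis by (auto simp: d_def split: list.splits)
  next
    case False
    then have "dropWhile (\<lambda>z. z = c) p \<noteq> []" by auto
    then obtain z zs where z: "dropWhile (\<lambda>z. z = c) p = z # zs" by (cases "dropWhile (\<lambda>z. z = c) p") auto
    have "dropWhile (\<lambda>z. z = c) u = dropWhile (\<lambda>z. z = c) p @ \<tau>"
      unfolding u using False by (auto simp: dropWhile_append)
    then have "d = z" using z by (simp add: d_def)
    moreover have "z \<in> set (dropWhile (\<lambda>z. z = c) p)" by (simp add: z)
    ultimately show ?thesis by (blast dest: set_dropWhileD)
  qed
  \<comment> \<open>Otherwise all of \<open>p\<close> would lie on the side of the letter after it,
    which would put \<open>c\<close> and \<open>d\<close> on the same side.\<close>
  have extreme: "word_pos ?A ?f p \<noteq> ?f (if \<tau> = [] then y else hd \<tau>) * (2 ^ length p - 1)"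
  proof
    assume eq: "word_pos ?A ?f p = ?f (if \<tau> = [] then y else hd \<tau>) * (2 ^ length p - 1)"
    have "?f z = ?f (if \<tau> = [] then y else hd \<tau>)" if "z \<in> set p" for z
      by (rule word_pos_extremeD[OF pA side_in side_in eq that])
    then show False using cp d_cases e(3) by metis
  qed
  have "label_pos e \<tau> u \<noteq> label_pos e \<tau> v"
  proof (cases "\<tau> = []")
    case True
    then have "x \<in> ?A" using u pA assms(1) by auto
    show ?thesis
    proof (cases "y \<in> ?A")
      case True
      \<comment> \<open>Different top digits place the positions in different halves of the
        cycle.\<close>
      then have "?f x \<noteq> ?f y" using \<open>x \<in> ?A\<close> side_inj_on_ends e(1) assms(4) by blast
      moreover have "word_pos ?A ?f a \<in> {0..<2 ^ length a}" "word_pos ?A ?f b \<in> {0..<2 ^ length a}"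
        using word_pos_bounds[of ?f] side_in assms(3) by metis+
      ultimately show ?thesis
        using \<open>\<tau> = []\<close> True \<open>x \<in> ?A\<close> assms(1-3) side_in[of E e x] side_in[of E e y]
        by (auto simp: word_pos_snoc)
    next
      case False
      then show ?thesis using extreme \<open>\<tau> = []\<close> u assms(1-3) by (auto simp: word_pos_snoc)
    qed
  next
    case False
    then have "last \<tau> = x" using u assms(1) by (metis last_appendR last_snoc)
    then have "\<not> suffix \<tau> v" using False assms(2,4) by (auto simp: suffix_def) (metis last_appendR last_snoc)
    then have "label_pos e \<tau> v = ?f (hd \<tau>) * (2 ^ length p - 1)"
      using u assms(1-3) by (simp add: cycle_pos_not_suffix) (metis add_diff_cancel_right' length_append length_append_singleton)
    then show ?thesis using extreme False u by simp
  qed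
  then show ?thesis using e(1) \<tau>_def by blast
qed

text \<open>The common suffix is stripped until the last letters differ and is put back with
  \<open>cycle_pos_neq_append\<close>.\<close>

lemma own_cycle_separates:
  assumes "u \<in> words V n" "v \<in> words V n" "u \<noteq> v"
  shows "\<exists>e\<in>E. label_pos e (own_suffix e u) u \<noteq> label_pos e (own_suffix e u) v"
proof -
  have len: "length u = length v" using assms by (simp add: words_def)
  have "\<exists>\<sigma> a b x y. u = (a @ [x]) @ \<sigma> \<and> v = (b @ [y]) @ \<sigma> \<and> length a = length b \<and> x \<noteq> y"
    using len assms(3)
  proof (induction u v rule: rev_induct2)
    case (4 x xs y ys)
    show ?case
    proof (cases "x = y")
      case True
      then have "xs \<noteq> ys" "length xs = length ys" using 4 by auto
      then obtain \<sigma> a b x' y' where "xs = (a @ [x']) @ \<sigma> \<and> ys = (b @ [y']) @ \<sigma> \<and> length a = length b \<and> x' \<noteq> y'"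
        using 4 by blast
      then show ?thesis using True by (intro exI[of _ "\<sigma> @ [x]"] exI[of _ a] exI[of _ b] exI[of _ x'] exI[of _ y']) simp
    next
      case False
      then show ?thesis using 4 by (intro exI[of _ "[]"] exI[of _ xs] exI[of _ ys] exI[of _ x] exI[of _ y]) simp
    qed
  qed auto
  then obtain \<sigma> a b x y where s: "u = (a @ [x]) @ \<sigma>" "v = (b @ [y]) @ \<sigma>" "length a = length b" "x \<noteq> y"
    by blast
  then have "set (a @ [x]) \<subseteq> V" "y \<in> V" using assms by (auto simp: words_def)
  from own_cycle_separates_last[OF refl refl s(3,4) this]
  obtain e where e: "e \<in> E" "label_pos e (own_suffix e (a @ [x])) (a @ [x]) \<noteq> label_pos e (own_suffix e (a @ [x])) (b @ [y])"
    by blast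
  from cycle_pos_neq_append[OF e(2), of \<sigma>] s(3) e(1) show ?thesis
    unfolding s(1,2) by auto
qed

lemma cactus_dist_descent:
  assumes u: "u \<in> words V n" and v: "v \<in> words V n" and "u \<noteq> v"
  shows "\<exists>u'. (u, u') \<in> schreier_rel V E n \<and> cactus_dist n u' v < cactus_dist n u v"
proof -
  obtain e where e: "e \<in> E" and ne: "label_pos e (own_suffix e u) u \<noteq> label_pos e (own_suffix e u) v"
    using own_cycle_separates assms by blast
  define \<tau> where "\<tau> = own_suffix e u"
  define N :: int where "N = 2 ^ (n - length \<tau>)"
  \<comment> \<open>Swapping the ends inverts the action, so \<open>u0\<close> precedes
    \<open>u\<close> on its cycle, and \<open>circ_dist_descent\<close> chooses between going
    forward and back.\<close>
  define u0 where "u0 = edge_act (snd e, fst e) u"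
  have u0: "u0 \<in> words V n" "edge_act e u0 = u"
    using edge_act_inverse_words[OF e u] by (simp_all add: u0_def)
  have \<tau>0: "own_suffix e u0 = \<tau>"
    using dropWhile_edge_act[of "fst e" "snd e" u0] u0(2) by (simp add: \<tau>_def)
  have lens: "length u = n" "length v = n" "length u0 = n" using u v u0 by (auto simp: words_def)
  have succ0: "circ_succ N (label_pos e \<tau> u0) = label_pos e \<tau> u"
    using cactus_dist_edge_act(1)[OF e u0(1)] unfolding \<tau>0 u0(2) N_def by (rule sym)
  have "circ_dist N (circ_succ N (label_pos e \<tau> u)) (label_pos e \<tau> v) < circ_dist N (label_pos e \<tau> u) (label_pos e \<tau> v)
     \<or> circ_dist N (label_pos e \<tau> u0) (label_pos e \<tau> v) < circ_dist N (label_pos e \<tau> u) (label_pos e \<tau> v)"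
    using circ_dist_descent[OF _ _ _ succ0] label_pos_bounds lens ne
    unfolding N_def \<tau>_def by blast
  moreover have "cactus_dist n (edge_act e u) v - cactus_dist n u v =
      circ_dist N (circ_succ N (label_pos e \<tau> u)) (label_pos e \<tau> v) - circ_dist N (label_pos e \<tau> u) (label_pos e \<tau> v)"
    using cactus_dist_edge_act(2)[OF e u] by (simp add: \<tau>_def N_def)
  moreover have "cactus_dist n u v - cactus_dist n u0 v =
      circ_dist N (label_pos e \<tau> u) (label_pos e \<tau> v) - circ_dist N (label_pos e \<tau> u0) (label_pos e \<tau> v)"
    using cactus_dist_edge_act(2)[OF e u0(1), of v] succ0 unfolding u0(2) \<tau>0 N_def by simp
  ultimately have "cactus_dist n (edge_act e u) v < cactus_dist n u v \<or> cactus_dist n u0 v < cactus_dist n u v"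
    by linarith
  moreover have "(u, edge_act e u) \<in> schreier_rel V E n" "(u, u0) \<in> schreier_rel V E n"
    using e u u0 edge_act_words[OF e u] by (auto simp: schreier_rel_def)
  ultimately show ?thesis by blast
qed

lemma gdist_schreier:
  assumes "u \<in> words V n" "v \<in> words V n"
  shows "int (gdist (schreier_rel V E n) u v) = cactus_dist n u v"
proof (rule int_gdist_eqI[where X = "words V n"])
  show "cactus_dist n u u = 0" for u
    by (auto simp: cactus_dist_def circ_dist_refl intro: sum.neutral)
  show "cactus_dist n u v \<ge> 0" if "u \<in> words V n" "v \<in> words V n" for u v
    using that label_pos_bounds[of u n] label_pos_bounds[of v n]
    unfolding cactus_dist_def words_def by (intro sum_nonneg) (auto intro!: circ_dist_nonneg simp del: atLeastLessThan_iff)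
  have step: "\<bar>cactus_dist n (edge_act e u) v - cactus_dist n u v\<bar> \<le> 1"
    if "e \<in> E" "u \<in> words V n" "v \<in> words V n" for e u v
    unfolding cactus_dist_edge_act(2)[OF that(1,2)]
    using that label_pos_bounds by (intro circ_dist_succ_le) (auto simp: words_def simp del: atLeastLessThan_iff)
  show "u' \<in> words V n \<and> cactus_dist n u v \<le> cactus_dist n u' v + 1"
    if uu': "(u, u') \<in> schreier_rel V E n" "v \<in> words V n" for u u' v
  proof -
    obtain e where "e \<in> E" "u \<in> words V n" "u' \<in> words V n" "u' = edge_act e u \<or> u = edge_act e u'"
      using uu'(1) unfolding schreier_rel_def by blast
    then show ?thesis using step[of e u v] step[of e u' v] uu'(2) by auto
  qed
qed (use cactus_dist_descent assms in blast)+

end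

section \<open>Summation over all pairs of words\<close>

text \<open>The points \<open>p\<close> and \<open>M + p\<close> are antipodal, so their distances
  to a third point add up to \<open>M\<close>. Here that point is 0 or \<open>2 * M - 1\<close>,
  where the outside words hang off.\<close>

lemma circ_dist_to_extreme:
  assumes "p \<in> {0..<M}" "c \<in> {0, 1}"
  shows "circ_dist (2 * M) (M + p) (c * (2 * M - 1)) + circ_dist (2 * M) p (c * (2 * M - 1)) = M"
  using assms by (auto simp: circ_dist_def)

lemma circ_dist_extremes:
  assumes "M \<ge> 1" "c \<in> {0, 1}" "d \<in> {0, 1}"
  shows "circ_dist (2 * M) (c * (2 * M - 1)) (d * (2 * M - 1)) = (if c = d then 0 else 1)"
  using assms by (auto simp: circ_dist_def)

text \<open>Antipodality is used twice, once with \<open>M + q\<close> and once with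
  \<open>q\<close> as the third point.\<close>

lemma circ_dist_two_pairs:
  assumes "p \<in> {0..<M}" "q \<in> {0..<M}"
  shows "circ_dist (2 * M) (M + p) (M + q) + circ_dist (2 * M) (M + p) q
    + (circ_dist (2 * M) p (M + q) + circ_dist (2 * M) p q) = 2 * M"
  using assms unfolding circ_dist_def atLeastLessThan_iff min_def abs_if by (smt (verit))

context tree_graph
begin

abbreviation num_letters :: int where "num_letters \<equiv> int (card V)"

abbreviation full_pos :: "'a \<times> 'a \<Rightarrow> 'a list \<Rightarrow> int" where
  "full_pos e \<equiv> word_pos (ends e) (side E e)"

abbreviation side_excess :: "'a \<times> 'a \<Rightarrow> int" where
  "side_excess e \<equiv> (side_card e 1 - 1) * (side_card e 0 - 1)"

lemma finite_words: "finite (words V n)"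
  using finite_lists_length_eq[OF finite_V, of n] by (simp add: words_def conj_commute)

lemma card_words: "int (card (words V n)) = num_letters ^ n"
  using card_lists_length_eq[OF finite_V, of n] by (simp add: words_def conj_commute)

lemma sum_words_snoc:
  "(\<Sum>u\<in>words V (Suc m). g u) = (\<Sum>w\<in>words V m. \<Sum>x\<in>V. g (w @ [x]))"
proof -
  have "words V (Suc m) = (\<lambda>(w, x). w @ [x]) ` (words V m \<times> V)"
  proof (intro equalityI subsetI)
    fix u assume "u \<in> words V (Suc m)"
    then show "u \<in> (\<lambda>(w, x). w @ [x]) ` (words V m \<times> V)"
      by (cases u rule: rev_cases) (auto simp: words_def)
  qed (auto simp: words_def)
  moreover have "inj_on (\<lambda>(w, x). w @ [x]) (words V m \<times> V)" by (auto simp: inj_on_def)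
  ultimately show ?thesis
    by (simp add: sum.reindex sum.cartesian_product case_prod_unfold)
qed

text \<open>A last letter in \<open>ends e\<close> sets the top digit; any other sends the word to
  the extreme point of its side.\<close>

lemma sum_full_pos_snoc:
  assumes e: "e \<in> E" and w: "w \<in> words V m"
  shows "(\<Sum>x\<in>V. h (full_pos e (w @ [x]))) =
    h (2 ^ m + full_pos e w) + h (full_pos e w)
    + (side_card e 1 - 1) * h (2 * 2 ^ m - 1) + (side_card e 0 - 1) * (h 0 :: int)"
proof -
  have len: "length w = m" using w by (simp add: words_def)
  have "h (full_pos e (w @ [x])) = h (side E e x * (2 * 2 ^ m - 1))" if "x \<notin> ends e" for x
    using that len by (simp add: word_pos_snoc)
  then show ?thesis
    using sum_over_sides[OF e, of "\<lambda>x. h (full_pos e (w @ [x]))" "\<lambda>c. h (c * (2 * 2 ^ m - 1))"] side_fst[of e] side_snd[OF e] len by (simp add: word_pos_snoc)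
qed

lemma full_pos_bounds: "w \<in> words V m \<Longrightarrow> full_pos e w \<in> {0..<2 ^ m}"
  using word_pos_bounds[of "side E e", OF side_in, of "ends e" w] by (auto simp: words_def)

text \<open>For fixed \<open>w\<close> the two ends give antipodal points, together
  \<open>2 ^ m\<close>; among the other letters just those on the side opposite to \<open>c\<close>
  are at distance 1.\<close>

lemma sum_circ_dist_root:
  assumes e: "e \<in> E" and c: "c \<in> {0, 1}"
  shows "(\<Sum>u\<in>words V (Suc m). circ_dist (2 ^ Suc m) (full_pos e u) (c * (2 ^ Suc m - 1)))
    = num_letters ^ m * (2 ^ m + side_card e (1 - c) - 1)"
proof -
  have "(\<Sum>x\<in>V. circ_dist (2 ^ Suc m) (full_pos e (w @ [x])) (c * (2 ^ Suc m - 1)))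
      = 2 ^ m + side_card e (1 - c) - 1" if w: "w \<in> words V m" for w
    using sum_full_pos_snoc[OF e w, of "\<lambda>a. circ_dist (2 ^ Suc m) a (c * (2 ^ Suc m - 1))"]
      circ_dist_to_extreme[OF full_pos_bounds[OF w, of e] c]
      circ_dist_extremes[of "2 ^ m" 1 c] circ_dist_extremes[of "2 ^ m" 0 c] c by auto
  then have "(\<Sum>u\<in>words V (Suc m). circ_dist (2 ^ Suc m) (full_pos e u) (c * (2 ^ Suc m - 1)))
      = (\<Sum>w\<in>words V m. 2 ^ m + side_card e (1 - c) - 1)"
    unfolding sum_words_snoc by (rule sum.cong[OF refl])
  then show ?thesis by (simp add: card_words)
qed

text \<open>Let \<open>a\<close>, \<open>b\<close> be the side sizes and \<open>M = 2 ^ m\<close>.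
  For fixed remaining letters, pairs of last letters with both in \<open>ends e\<close> give
  \<open>2 * M\<close>, with exactly one there \<open>2 * M * (a + b - 2)\<close>, with none
  \<open>2 * (a - 1) * (b - 1)\<close>.\<close>

lemma sum_circ_dist_pairs:
  assumes e: "e \<in> E"
  shows "(\<Sum>u\<in>words V (Suc m). \<Sum>v\<in>words V (Suc m). circ_dist (2 ^ Suc m) (full_pos e u) (full_pos e v))
    = 2 * (num_letters ^ m * num_letters ^ m) * ((num_letters - 1) * 2 ^ m + side_excess e)"
proof -
  define M :: int where "M = 2 ^ m"
  have M: "M \<ge> 1" by (simp add: M_def)
  define a b where "a = side_card e 1" and "b = side_card e 0"
  have ab: "num_letters = a + b" using side_card_add[of e] by (simp add: a_def b_def)
  have inner: "(\<Sum>x\<in>V. \<Sum>y\<in>V. circ_dist (2 * M) (full_pos e (w @ [x])) (full_pos e (z @ [y])))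
      = 2 * ((num_letters - 1) * M + (a - 1) * (b - 1))" if w: "w \<in> words V m" and z: "z \<in> words V m" for w z
  proof -
    define p q where "p = full_pos e w" and "q = full_pos e z"
    have pq: "p \<in> {0..<M}" "q \<in> {0..<M}"
      using full_pos_bounds[OF w, of e] full_pos_bounds[OF z, of e] by (simp_all add: p_def q_def M_def)
    define h where "h r = circ_dist (2 * M) r (M + q) + circ_dist (2 * M) r q
      + (a - 1) * circ_dist (2 * M) r (2 * M - 1) + (b - 1) * circ_dist (2 * M) r 0" for r
    have "(\<Sum>y\<in>V. circ_dist (2 * M) r (full_pos e (z @ [y]))) = h r" for r
      using sum_full_pos_snoc[OF e z, of "circ_dist (2 * M) r"]
      by (simp add: h_def a_def b_def M_def q_def)
    then have "(\<Sum>x\<in>V. \<Sum>y\<in>V. circ_dist (2 * M) (full_pos e (w @ [x])) (full_pos e (z @ [y])))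
      = (\<Sum>x\<in>V. h (full_pos e (w @ [x])))" by simp
    also have "\<dots> = h (M + p) + h p + (a - 1) * h (2 * M - 1) + (b - 1) * h 0"
      using sum_full_pos_snoc[OF e w, of h] by (simp add: a_def b_def M_def p_def)
    also have "h (M + p) + h p = 2 * M + (a - 1) * M + (b - 1) * M"
    proof -
      have "h (M + p) + h p =
          circ_dist (2 * M) (M + p) (M + q) + circ_dist (2 * M) (M + p) q
          + (circ_dist (2 * M) p (M + q) + circ_dist (2 * M) p q)
          + (a - 1) * (circ_dist (2 * M) (M + p) (2 * M - 1) + circ_dist (2 * M) p (2 * M - 1))
          + (b - 1) * (circ_dist (2 * M) (M + p) 0 + circ_dist (2 * M) p 0)"
        by (simp add: h_def algebra_simps)
      then show ?thesis
        using circ_dist_two_pairs[OF pq] circ_dist_to_extreme[OF pq(1), of 1]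
          circ_dist_to_extreme[OF pq(1), of 0] by simp
    qed
    also have "h (2 * M - 1) = M + (b - 1)"
      using circ_dist_to_extreme[OF pq(2), of 1] circ_dist_extremes[OF M, of 1 1] circ_dist_extremes[OF M, of 1 0]
        circ_dist_commute[of "2 * M" "2 * M - 1" "M + q"] circ_dist_commute[of "2 * M" "2 * M - 1" q]
      by (simp add: h_def)
    also have "h 0 = M + (a - 1)"
      using circ_dist_to_extreme[OF pq(2), of 0] circ_dist_extremes[OF M, of 0 1] circ_dist_extremes[OF M, of 0 0]
        circ_dist_commute[of "2 * M" 0 "M + q"] circ_dist_commute[of "2 * M" 0 q]
      by (simp add: h_def)
    finally show ?thesis unfolding ab by (simp add: algebra_simps)
  qed
  have "(\<Sum>u\<in>words V (Suc m). \<Sum>v\<in>words V (Suc m). circ_dist (2 ^ Suc m) (full_pos e u) (full_pos e v))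
      = (\<Sum>w\<in>words V m. \<Sum>x\<in>V. \<Sum>z\<in>words V m. \<Sum>y\<in>V.
          circ_dist (2 * M) (full_pos e (w @ [x])) (full_pos e (z @ [y])))"
    unfolding sum_words_snoc by (simp add: M_def)
  also have "\<dots> = (\<Sum>w\<in>words V m. \<Sum>z\<in>words V m. \<Sum>x\<in>V. \<Sum>y\<in>V.
          circ_dist (2 * M) (full_pos e (w @ [x])) (full_pos e (z @ [y])))"
    by (intro sum.cong refl sum.swap)
  also have "\<dots> = (\<Sum>w\<in>words V m. \<Sum>z\<in>words V m. 2 * ((num_letters - 1) * M + (a - 1) * (b - 1)))"
    by (intro sum.cong refl inner)
  also have "\<dots> = 2 * (num_letters ^ m * num_letters ^ m) * ((num_letters - 1) * M + (a - 1) * (b - 1))"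
    by (simp add: card_words)
  finally show ?thesis by (simp add: M_def a_def b_def)
qed

text \<open>All words without suffix \<open>\<tau>\<close> project to one point \<open>r\<close>, so
  only pairs with both words ending in \<open>\<tau>\<close> and mixed pairs contribute, the latter
  in both orders.\<close>

lemma sum_cycle_pairs:
  assumes e: "e \<in> E" and \<tau>: "set \<tau> \<subseteq> V" "n = Suc m + length \<tau>"
  shows "(\<Sum>u\<in>words V n. \<Sum>v\<in>words V n. circ_dist (2 ^ (n - length \<tau>)) (label_pos e \<tau> u) (label_pos e \<tau> v))
    = 2 * (num_letters ^ m * num_letters ^ m) * ((num_letters - 1) * 2 ^ m + side_excess e)
      + 2 * (num_letters ^ n - num_letters ^ Suc m) * (num_letters ^ m * (2 ^ m + side_card e (1 - side E e (hd \<tau>)) - 1))"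
proof -
  define S where "S = (\<lambda>p. p @ \<tau>) ` words V (Suc m)"
  \<comment> \<open>For \<open>\<tau> = []\<close> the value of \<open>hd\<close> is arbitrary, but
    then no word lies outside \<open>S\<close> and the mixed term has factor 0.\<close>
  define c where "c = side E e (hd \<tau>)"
  define r :: int where "r = c * (2 ^ Suc m - 1)"
  let ?D = "circ_dist (2 ^ Suc m)"
  let ?g = "\<lambda>u v. ?D (label_pos e \<tau> u) (label_pos e \<tau> v)"
  have SW: "S \<subseteq> words V n" using \<tau> by (auto simp: S_def words_def)
  have inj: "inj_on (\<lambda>p. p @ \<tau>) (words V (Suc m))" by (auto simp: inj_on_def)
  have finS: "finite S" using finite_words by (simp add: S_def)
  have cardS: "int (card S) = num_letters ^ Suc m" using card_image[OF inj] card_words by (simp add: S_def)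
  have cardR: "int (card (words V n - S)) = num_letters ^ n - num_letters ^ Suc m"
    using card_Diff_subset[OF finS SW] card_mono[OF finite_words SW] cardS card_words[of n]
    by (simp add: of_nat_diff)
  have out: "label_pos e \<tau> v = r" if v: "v \<in> words V n - S" for v
  proof -
    have "\<not> suffix \<tau> v"
    proof
      assume "suffix \<tau> v"
      then obtain p where "v = p @ \<tau>" by (auto simp: suffix_def)
      then show False using v \<tau> by (auto simp: S_def words_def)
    qed
    then show ?thesis using v \<tau> by (simp add: cycle_pos_not_suffix words_def r_def c_def)
  qed
  have split: "(\<Sum>v\<in>words V n. f v) = (\<Sum>p\<in>words V (Suc m). f (p @ \<tau>)) + (\<Sum>v\<in>words V n - S. f v)"
    for f :: "'a list \<Rightarrow> int"
    using sum.subset_diff[OF SW finite_words, of f] sum.reindex[OF inj, of f] by (simp add: S_def)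
  have c: "c \<in> {0, 1}" using side_in by (simp add: c_def)
  have row: "(\<Sum>v\<in>words V n. ?D a (label_pos e \<tau> v)) =
      (\<Sum>q\<in>words V (Suc m). ?D a (full_pos e q)) + (num_letters ^ n - num_letters ^ Suc m) * ?D a r" for a
    unfolding split using out cardR by simp
  have root: "(\<Sum>q\<in>words V (Suc m). ?D (full_pos e q) r) = num_letters ^ m * (2 ^ m + side_card e (1 - c) - 1)"
    unfolding r_def by (rule sum_circ_dist_root[OF e c])
  have commute: "(\<Sum>q\<in>words V (Suc m). ?D r (full_pos e q)) = (\<Sum>q\<in>words V (Suc m). ?D (full_pos e q) r)"
    by (intro sum.cong refl circ_dist_commute)
  have "(\<Sum>u\<in>words V n. \<Sum>v\<in>words V n. ?g u v) =
      (\<Sum>p\<in>words V (Suc m). \<Sum>v\<in>words V n. ?D (full_pos e p) (label_pos e \<tau> v))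
      + (\<Sum>u\<in>words V n - S. \<Sum>v\<in>words V n. ?D r (label_pos e \<tau> v))"
    unfolding split[of "\<lambda>u. \<Sum>v\<in>words V n. ?g u v"] using out by simp
  also have "(\<Sum>p\<in>words V (Suc m). \<Sum>v\<in>words V n. ?D (full_pos e p) (label_pos e \<tau> v)) =
      (\<Sum>p\<in>words V (Suc m). \<Sum>q\<in>words V (Suc m). ?D (full_pos e p) (full_pos e q))
      + (num_letters ^ n - num_letters ^ Suc m) * (\<Sum>p\<in>words V (Suc m). ?D (full_pos e p) r)"
    unfolding row by (simp add: sum.distrib sum_distrib_left)
  also have "(\<Sum>u\<in>words V n - S. \<Sum>v\<in>words V n. ?D r (label_pos e \<tau> v)) =
      (num_letters ^ n - num_letters ^ Suc m) * (\<Sum>q\<in>words V (Suc m). ?D (full_pos e q) r)"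
    unfolding row using cardR commute by (simp add: circ_dist_refl)
  finally have "(\<Sum>u\<in>words V n. \<Sum>v\<in>words V n. ?g u v) =
      2 * (num_letters ^ m * num_letters ^ m) * ((num_letters - 1) * 2 ^ m + side_excess e)
      + 2 * (num_letters ^ n - num_letters ^ Suc m) * (num_letters ^ m * (2 ^ m + side_card e (1 - c) - 1))"
    unfolding sum_circ_dist_pairs[OF e] root by simp
  then show ?thesis using \<tau> by (simp add: c_def)
qed

definition cycle_suffixes :: "'a \<times> 'a \<Rightarrow> nat \<Rightarrow> 'a list set" where
  "cycle_suffixes e j = {\<tau> \<in> words V j. \<tau> = [] \<or> hd \<tau> \<notin> ends e}"

lemma cycle_suffixes_0: "cycle_suffixes e 0 = {[]}"
  by (auto simp: cycle_suffixes_def words_def)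

lemma sum_cycle_suffixes_Suc:
  "(\<Sum>\<tau>\<in>cycle_suffixes e (Suc i). f \<tau>) = (\<Sum>x\<in>V - ends e. \<Sum>w\<in>words V i. f (x # w))"
proof -
  have "cycle_suffixes e (Suc i) = (\<lambda>(x, w). x # w) ` ((V - ends e) \<times> words V i)"
  proof (intro equalityI subsetI)
    fix \<tau> assume "\<tau> \<in> cycle_suffixes e (Suc i)"
    then show "\<tau> \<in> (\<lambda>(x, w). x # w) ` ((V - ends e) \<times> words V i)"
      by (cases \<tau>) (auto simp: cycle_suffixes_def words_def)
  qed (auto simp: cycle_suffixes_def words_def)
  moreover have "inj_on (\<lambda>(x, w). x # w) ((V - ends e) \<times> words V i)" by (auto simp: inj_on_def)
  ultimately show ?thesis
    by (simp add: sum.reindex sum.cartesian_product case_prod_unfold)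
qed

lemma sum_cycle_index:
  "(\<Sum>(e, \<tau>)\<in>cycle_index n. f e \<tau>) = (\<Sum>e\<in>E. \<Sum>j\<le>n. \<Sum>\<tau>\<in>cycle_suffixes e j. f e \<tau>)"
proof -
  have idx: "cycle_index n = Sigma E (\<lambda>e. \<Union>j\<in>{..n}. cycle_suffixes e j)"
    by (auto simp: cycle_index_def cycle_suffixes_def words_def)
  have fin: "finite (cycle_suffixes e j)" for e j
    using finite_words by (simp add: cycle_suffixes_def)
  have "(\<Sum>(e, \<tau>)\<in>cycle_index n. f e \<tau>) = (\<Sum>e\<in>E. \<Sum>\<tau>\<in>(\<Union>j\<in>{..n}. cycle_suffixes e j). f e \<tau>)"
    unfolding idx by (rule sum.Sigma[symmetric]) (use finite_E fin in auto)
  also have "\<dots> = (\<Sum>e\<in>E. \<Sum>j\<le>n. \<Sum>\<tau>\<in>cycle_suffixes e j. f e \<tau>)"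
    by (intro sum.cong refl sum.UNION_disjoint) (use fin in \<open>auto simp: cycle_suffixes_def words_def\<close>)
  finally show ?thesis .
qed

text \<open>Cycles are grouped by label and length \<open>2 ^ Suc m\<close>. The separate first term
  is the full cycle; for \<open>m < N\<close> the suffix has a first letter outside
  \<open>ends e\<close>, summed by sides, and then \<open>N - Suc m\<close> arbitrary
  letters.\<close>

lemma sum_cactus_dist:
  "(\<Sum>u\<in>words V (Suc N). \<Sum>v\<in>words V (Suc N). cactus_dist (Suc N) u v) =
    (\<Sum>e\<in>E. 2 * (num_letters ^ N * num_letters ^ N) * ((num_letters - 1) * 2 ^ N + side_excess e)
      + (\<Sum>m<N. num_letters ^ (N - Suc m) *
          ((num_letters - 2) * (2 * (num_letters ^ m * num_letters ^ m) * ((num_letters - 1) * 2 ^ m + side_excess e))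
           + 2 * (num_letters ^ Suc N - num_letters ^ Suc m) * (num_letters ^ m * ((num_letters - 2) * 2 ^ m + 2 * side_excess e)))))"
proof -
  let ?n = "Suc N"
  define F where "F e \<tau> = (\<Sum>u\<in>words V ?n. \<Sum>v\<in>words V ?n.
      circ_dist (2 ^ (?n - length \<tau>)) (label_pos e \<tau> u) (label_pos e \<tau> v))" for e \<tau>
  define P where "P e m = 2 * (num_letters ^ m * num_letters ^ m) * ((num_letters - 1) * 2 ^ m + side_excess e)" for e m
  have "(\<Sum>u\<in>words V ?n. \<Sum>v\<in>words V ?n. cactus_dist ?n u v) =
      (\<Sum>u\<in>words V ?n. \<Sum>i\<in>cycle_index ?n. \<Sum>v\<in>words V ?n.
        case i of (e, \<tau>) \<Rightarrow> circ_dist (2 ^ (?n - length \<tau>)) (label_pos e \<tau> u) (label_pos e \<tau> v))"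
    unfolding cactus_dist_def by (intro sum.cong refl sum.swap)
  also have "\<dots> = (\<Sum>i\<in>cycle_index ?n. \<Sum>u\<in>words V ?n. \<Sum>v\<in>words V ?n.
        case i of (e, \<tau>) \<Rightarrow> circ_dist (2 ^ (?n - length \<tau>)) (label_pos e \<tau> u) (label_pos e \<tau> v))"
    by (rule sum.swap)
  also have "\<dots> = (\<Sum>(e, \<tau>)\<in>cycle_index ?n. F e \<tau>)"
    by (simp add: F_def case_prod_unfold)
  also have "\<dots> = (\<Sum>e\<in>E. \<Sum>j\<le>?n. \<Sum>\<tau>\<in>cycle_suffixes e j. F e \<tau>)"
    by (rule sum_cycle_index)
  also have "\<dots> = (\<Sum>e\<in>E. P e N + (\<Sum>m<N. num_letters ^ (N - Suc m) * ((num_letters - 2) * P e m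
           + 2 * (num_letters ^ ?n - num_letters ^ Suc m) * (num_letters ^ m * ((num_letters - 2) * 2 ^ m + 2 * side_excess e)))))"
  proof (rule sum.cong[OF refl])
    fix e assume e: "e \<in> E"
    have zero: "(\<Sum>\<tau>\<in>cycle_suffixes e 0. F e \<tau>) = P e N"
      unfolding cycle_suffixes_0 F_def using sum_cycle_pairs[OF e, of "[]" ?n N] by (simp add: P_def)
    \<comment> \<open>Suffixes of full length belong to cycles with a single point.\<close>
    have top: "(\<Sum>\<tau>\<in>cycle_suffixes e ?n. F e \<tau>) = 0"
    proof (rule sum.neutral, rule ballI)
      fix \<tau> assume "\<tau> \<in> cycle_suffixes e ?n"
      then have len: "length \<tau> = ?n" by (simp add: cycle_suffixes_def words_def)
      have "label_pos e \<tau> u = 0" if "u \<in> words V ?n" for u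
        using label_pos_bounds[of u ?n e \<tau>] that len by (simp add: words_def)
      then show "F e \<tau> = 0" by (simp add: F_def len circ_dist_refl)
    qed
    have mid: "(\<Sum>\<tau>\<in>cycle_suffixes e (Suc (N - Suc m)). F e \<tau>) =
        num_letters ^ (N - Suc m) * ((num_letters - 2) * P e m
           + 2 * (num_letters ^ ?n - num_letters ^ Suc m) * (num_letters ^ m * ((num_letters - 2) * 2 ^ m + 2 * side_excess e)))"
      if m: "m < N" for m
    proof -
      define G where "G c = P e m + 2 * (num_letters ^ ?n - num_letters ^ Suc m) * (num_letters ^ m * (2 ^ m + side_card e (1 - c) - 1))" for c
      have F: "F e (x # w) = G (side E e x)" if "x \<in> V - ends e" "w \<in> words V (N - Suc m)" for x w
      proof -
        have "set (x # w) \<subseteq> V" "?n = Suc m + length (x # w)" using that m by (auto simp: words_def)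
        from sum_cycle_pairs[OF e this] show ?thesis unfolding F_def G_def P_def list.sel .
      qed
      have "(\<Sum>\<tau>\<in>cycle_suffixes e (Suc (N - Suc m)). F e \<tau>) =
          (\<Sum>x\<in>V - ends e. \<Sum>w\<in>words V (N - Suc m). G (side E e x))"
        unfolding sum_cycle_suffixes_Suc using F by (intro sum.cong refl) auto
      also have "\<dots> = num_letters ^ (N - Suc m) * (\<Sum>x\<in>V - ends e. G (side E e x))"
        by (simp add: card_words sum_distrib_left)
      also have "(\<Sum>x\<in>V - ends e. G (side E e x)) = (\<Sum>x\<in>V. if x \<in> ends e then 0 else G (side E e x))"
        using finite_V by (intro sum.mono_neutral_cong_left) auto
      also have "\<dots> = (side_card e 1 - 1) * G 1 + (side_card e 0 - 1) * G 0"
        using sum_over_sides[OF e, of "\<lambda>x. if x \<in> ends e then 0 else G (side E e x)" G] by simp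
      also have "\<dots> = (num_letters - 2) * P e m
           + 2 * (num_letters ^ ?n - num_letters ^ Suc m) * (num_letters ^ m * ((num_letters - 2) * 2 ^ m + 2 * side_excess e))"
        unfolding G_def side_card_add[of e, symmetric] by (simp add: algebra_simps)
      finally show ?thesis .
    qed
    have "(\<Sum>j\<le>?n. \<Sum>\<tau>\<in>cycle_suffixes e j. F e \<tau>) = P e N + (\<Sum>i<N. \<Sum>\<tau>\<in>cycle_suffixes e (Suc i). F e \<tau>)"
      using zero top by (simp add: sum.atMost_shift)
    \<comment> \<open>Reversing the summation passes from suffix length to cycle level.\<close>
    also have "(\<Sum>i<N. \<Sum>\<tau>\<in>cycle_suffixes e (Suc i). F e \<tau>) =
        (\<Sum>m<N. \<Sum>\<tau>\<in>cycle_suffixes e (Suc (N - Suc m)). F e \<tau>)"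
      by (rule sum.nat_diff_reindex[symmetric])
    finally show "(\<Sum>j\<le>?n. \<Sum>\<tau>\<in>cycle_suffixes e j. F e \<tau>) = P e N + (\<Sum>m<N. num_letters ^ (N - Suc m) * ((num_letters - 2) * P e m
           + 2 * (num_letters ^ ?n - num_letters ^ Suc m) * (num_letters ^ m * ((num_letters - 2) * 2 ^ m + 2 * side_excess e))))"
      using mid by simp
  qed
  finally show ?thesis by (simp add: P_def)
qed

end

section \<open>Closed form of the sum over all cycles\<close>

text \<open>The product \<open>k ^ (N - Suc m) * k ^ m\<close> does not depend on \<open>m\<close>,
  so the summand splits into geometric progressions with ratios \<open>2 * k\<close>,
  \<open>k\<close> and 2, and a constant.\<close>

lemma cycle_sum_closed_form:
  fixes k C :: real
  assumes "k > 1"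
  shows "(\<Sum>m<N. k ^ (N - Suc m) * ((k - 2) * (2 * (k ^ m * k ^ m) * ((k - 1) * 2 ^ m + C))
           + 2 * (k ^ Suc N - k ^ Suc m) * (k ^ m * ((k - 2) * 2 ^ m + 2 * C)))) =
    k ^ N / k * (- 2 * (k - 2) * ((2 ^ N * k ^ N - 1) / (2 * k - 1))
      - 2 * (k + 2) * C * ((k ^ N - 1) / (k - 1))
      + 2 * k * k ^ N * (k - 2) * (2 ^ N - 1) + 4 * k * k ^ N * C * N)"
proof -
  have "k ^ (N - Suc m) * ((k - 2) * (2 * (k ^ m * k ^ m) * ((k - 1) * 2 ^ m + C))
           + 2 * (k ^ Suc N - k ^ Suc m) * (k ^ m * ((k - 2) * 2 ^ m + 2 * C))) =
      k ^ N / k * (- 2 * (k - 2) * (2 * k) ^ m - 2 * (k + 2) * C * k ^ m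
        + 2 * k * k ^ N * (k - 2) * 2 ^ m + 4 * k * k ^ N * C)" if "m < N" for m
  proof -
    have "k ^ N = k ^ (N - Suc m) * (k ^ m * k)"
      using that by (metis Suc_leI le_add_diff_inverse2 power_Suc2 power_add)
    then have c: "k ^ (N - Suc m) * k ^ m = k ^ N / k" using assms by simp
    have "k ^ (N - Suc m) * ((k - 2) * (2 * (k ^ m * k ^ m) * ((k - 1) * 2 ^ m + C))
           + 2 * (k ^ Suc N - k ^ Suc m) * (k ^ m * ((k - 2) * 2 ^ m + 2 * C))) =
      (k ^ (N - Suc m) * k ^ m) * ((k - 2) * (2 * k ^ m * ((k - 1) * 2 ^ m + C))
           + 2 * (k ^ Suc N - k ^ Suc m) * ((k - 2) * 2 ^ m + 2 * C))"
      by (simp add: algebra_simps)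
    then show ?thesis unfolding c power_mult_distrib by (simp add: algebra_simps)
  qed
  then have "(\<Sum>m<N. k ^ (N - Suc m) * ((k - 2) * (2 * (k ^ m * k ^ m) * ((k - 1) * 2 ^ m + C))
           + 2 * (k ^ Suc N - k ^ Suc m) * (k ^ m * ((k - 2) * 2 ^ m + 2 * C)))) =
      (\<Sum>m<N. k ^ N / k * (- 2 * (k - 2) * (2 * k) ^ m - 2 * (k + 2) * C * k ^ m
        + 2 * k * k ^ N * (k - 2) * 2 ^ m + 4 * k * k ^ N * C))"
    by (intro sum.cong) auto
  also have "\<dots> = k ^ N / k * (- 2 * (k - 2) * (\<Sum>m<N. (2 * k) ^ m) - 2 * (k + 2) * C * (\<Sum>m<N. k ^ m)
        + 2 * k * k ^ N * (k - 2) * (\<Sum>m<N. 2 ^ m) + 4 * k * k ^ N * C * N)"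
    by (simp only: sum_distrib_left[symmetric] sum.distrib sum_subtractf sum_constant card_lessThan mult.commute[of "real N"] mult.assoc)
  also have "(\<Sum>m<N. (2 * k) ^ m) = (2 ^ N * k ^ N - 1) / (2 * k - 1)"
    using assms by (subst geometric_sum) (auto simp: power_mult_distrib)
  also have "(\<Sum>m<N. k ^ m) = (k ^ N - 1) / (k - 1)"
    using assms by (subst geometric_sum) auto
  also have "(\<Sum>m<N. 2 ^ m) = (2 ^ N - 1 :: real)"
    by (subst geometric_sum) auto
  finally show ?thesis .
qed

text \<open>\<open>X\<close> and \<open>Y\<close> are the constant part and the coefficient of the
  side excess in the contribution of one edge. With \<open>K\<close> for \<open>k ^ N\<close> and
  \<open>T\<close> for \<open>2 ^ N\<close> as free variables, an identity of rational functions
  remains.\<close>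

lemma wiener_closed_form:
  fixes k K T N W :: real
  assumes "k > 1"
  defines "X \<equiv> 2 * (K * K) * ((k - 1) * T)
      + K / k * (- 2 * (k - 2) * ((T * K - 1) / (2 * k - 1)) + 2 * k * K * (k - 2) * (T - 1))"
    and "Y \<equiv> 2 * (K * K) + K / k * (- 2 * (k + 2) * ((K - 1) / (k - 1)) + 4 * k * K * N)"
  shows "((k - 1) * X + Y * (W - (k - 1) * (k - 1))) / 2 =
      (k - 1)^2 * (2 * k^2 - 2 * k - 1) / (k^3 * (2 * k - 1)) * (2 * T) * (k^2 * K^2)
    - 2 * (k - 1)^2 / k^2 * (N + 1) * (k^2 * K^2)
    + 2 * (k + 1) * (k - 1) / k^3 * (k^2 * K^2)
    - 2 * (k + 1) * (k - 1) / (k * (2 * k - 1)) * (k * K)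
    + (2 / k^2 * (N + 1) * (k^2 * K^2) - (k^2 + 2) / (k^3 * (k - 1)) * (k^2 * K^2)
       + (k + 2) / (k^2 * (k - 1)) * (k * K)) * W"
proof -
  have nz: "k \<noteq> 0" "k - 1 \<noteq> 0" "2 * k - 1 \<noteq> 0" using assms by auto
  show ?thesis
    unfolding X_def Y_def using nz by (simp add: divide_simps) algebra
qed

context tree_graph
begin

text \<open>Each edge contributes an affine function of \<open>side_excess e\<close>. For side sizes
  \<open>a\<close>, \<open>b\<close> this excess is \<open>a * b - (\<kappa> - 1)\<close>, so
  summing over the \<open>\<kappa> - 1\<close> edges brings in the Wiener index of the tree.\<close>

lemma wiener_schreier_eq:
  fixes N :: nat
  assumes "card V > 1"
  defines "\<kappa> \<equiv> real (card V)"
  defines "K \<equiv> \<kappa> ^ N" and "T \<equiv> 2 ^ N"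
  defines "X \<equiv> 2 * (K * K) * ((\<kappa> - 1) * T)
      + K / \<kappa> * (- 2 * (\<kappa> - 2) * ((T * K - 1) / (2 * \<kappa> - 1)) + 2 * \<kappa> * K * (\<kappa> - 2) * (T - 1))"
    and "Y \<equiv> 2 * (K * K) + K / \<kappa> * (- 2 * (\<kappa> + 2) * ((K - 1) / (\<kappa> - 1)) + 4 * \<kappa> * K * N)"
  shows "wiener (words V (Suc N)) (schreier_rel V E (Suc N)) =
    ((\<kappa> - 1) * X + Y * (wiener V (adj_rel E) - (\<kappa> - 1) * (\<kappa> - 1))) / 2"
proof -
  let ?n = "Suc N"
  have \<kappa>: "\<kappa> > 1" using assms(1) by (simp add: \<kappa>_def)
  define C where "C e = real_of_int (side_excess e)" for e
  have cardE: "real (card E) = \<kappa> - 1" using card_edges by (simp add: \<kappa>_def flip: of_nat_add card_edges)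
  have "C e = of_int (side_card e 1 * side_card e 0) - (\<kappa> - 1)" for e
  proof -
    have "\<kappa> = of_int (side_card e 1) + of_int (side_card e 0)"
      using arg_cong[OF side_card_add[of e], of real_of_int] by (simp add: \<kappa>_def)
    then show ?thesis by (simp add: C_def algebra_simps)
  qed
  then have sumC: "(\<Sum>e\<in>E. C e) = wiener V (adj_rel E) - (\<kappa> - 1) * (\<kappa> - 1)"
    by (simp add: wiener_tree sum_subtractf cardE)
  have regroup: "2 * (K * K) * ((\<kappa> - 1) * T + c)
      + q * (- 2 * (\<kappa> - 2) * g1 - 2 * (\<kappa> + 2) * c * g2
        + 2 * \<kappa> * K * (\<kappa> - 2) * (T - 1) + 4 * \<kappa> * K * c * N) =
      2 * (K * K) * ((\<kappa> - 1) * T) + q * (- 2 * (\<kappa> - 2) * g1 + 2 * \<kappa> * K * (\<kappa> - 2) * (T - 1))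
      + (2 * (K * K) + q * (- 2 * (\<kappa> + 2) * g2 + 4 * \<kappa> * K * N)) * c" for c q g1 g2
    by (simp add: algebra_simps)
  have "(\<Sum>u\<in>words V ?n. \<Sum>v\<in>words V ?n. int (gdist (schreier_rel V E ?n) u v)) =
      (\<Sum>u\<in>words V ?n. \<Sum>v\<in>words V ?n. cactus_dist ?n u v)"
    by (intro sum.cong refl gdist_schreier)
  from arg_cong[OF this, of real_of_int]
  have "2 * wiener (words V ?n) (schreier_rel V E ?n) =
      real_of_int (\<Sum>u\<in>words V ?n. \<Sum>v\<in>words V ?n. cactus_dist ?n u v)"
    by (simp add: wiener_def)
  also have "\<dots> = (\<Sum>e\<in>E. 2 * (\<kappa> ^ N * \<kappa> ^ N) * ((\<kappa> - 1) * 2 ^ N + C e)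
      + (\<Sum>m<N. \<kappa> ^ (N - Suc m) *
          ((\<kappa> - 2) * (2 * (\<kappa> ^ m * \<kappa> ^ m) * ((\<kappa> - 1) * 2 ^ m + C e))
           + 2 * (\<kappa> ^ Suc N - \<kappa> ^ Suc m) * (\<kappa> ^ m * ((\<kappa> - 2) * 2 ^ m + 2 * C e)))))"
    unfolding sum_cactus_dist by (simp add: C_def \<kappa>_def)
  also have "\<dots> = (\<Sum>e\<in>E. X + Y * C e)"
    unfolding cycle_sum_closed_form[OF \<kappa>] X_def Y_def K_def[symmetric] T_def[symmetric]
    using regroup by (intro sum.cong refl) blast
  also have "\<dots> = (\<kappa> - 1) * X + Y * (wiener V (adj_rel E) - (\<kappa> - 1) * (\<kappa> - 1))"
    by (simp add: sum.distrib cardE sumC flip: sum_distrib_left)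
  finally show ?thesis by simp
qed

end

theorem theorem5p1:
  fixes V :: "'a set" and E :: "('a \<times> 'a) set" and n :: nat
  assumes "oriented_tree V E" and "n \<ge> 1"
  defines "k \<equiv> real (card V)"
  shows "wiener (words V n) (schreier_rel V E n) =
      (k - 1)^2 * (2 * k^2 - 2 * k - 1) / (k^3 * (2 * k - 1)) * 2^n * k^(2*n)
    - 2 * (k - 1)^2 / k^2 * n * k^(2*n)
    + 2 * (k + 1) * (k - 1) / k^3 * k^(2*n)
    - 2 * (k + 1) * (k - 1) / (k * (2 * k - 1)) * k^n
    + (2 / k^2 * n * k^(2*n) - (k^2 + 2) / (k^3 * (k - 1)) * k^(2*n)
       + (k + 2) / (k^2 * (k - 1)) * k^n) * wiener V {(x, y). adj E x y}"
proof -
  interpret tree_graph V E using assms(1) by (rule tree_graph.intro)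
  obtain N where n: "n = Suc N" using assms(2) by (cases n) auto
  show ?thesis
  proof (cases "card V > 1")
    case True
    have k: "k > 1" using True by (simp add: k_def)
    have "k ^ (2 * n) = (k * k ^ N)\<^sup>2" by (simp only: n power_even_eq power_Suc)
    then have pow: "real n = real N + 1" "2 ^ n = 2 * (2 ^ N :: real)" "k ^ n = k * k ^ N"
        "k ^ (2 * n) = k\<^sup>2 * (k ^ N)\<^sup>2"
      by (simp_all only: n of_nat_Suc power_Suc power_mult_distrib add.commute)
    show ?thesis
      unfolding pow wiener_closed_form[OF k, symmetric]
      using wiener_schreier_eq[OF True, of N] unfolding n k_def by simp
  next
    case False
    \<comment> \<open>For a single vertex the terms divided by \<open>k - 1 = 0\<close> are multiplied by a vanishing Wiener index.\<close>
    then have one: "card V = 1" using card_edges by linarith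
    then have "E = {}" using card_edges finite_E by simp
    have "(\<Sum>u\<in>words V n. \<Sum>v\<in>words V n. int (gdist (schreier_rel V E n) u v)) =
      (\<Sum>u\<in>words V n. \<Sum>v\<in>words V n. cactus_dist n u v)"
      by (intro sum.cong refl gdist_schreier)
    also have "\<dots> = 0" using sum_cactus_dist[of N] \<open>E = {}\<close> n by simp
    finally have "(\<Sum>u\<in>words V n. \<Sum>v\<in>words V n. real (gdist (schreier_rel V E n) u v)) = 0"
      by (metis (mono_tags, lifting) of_int_0 of_int_of_nat_eq of_int_sum sum.cong)
    then have "wiener (words V n) (schreier_rel V E n) = 0" by (simp add: wiener_def)
    moreover have "wiener V (adj_rel E) = 0" unfolding wiener_tree using \<open>E = {}\<close> by simp
    ultimately show ?thesis using one by (simp add: k_def)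
  qed
qed

end
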